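(* Suppose that $n\ge e^{12}$ and $\mathrm{A}_n\le G\le \mathrm{S}_n$. Let $\rho_G$ be the proportion of permutations in $G$ that power to a cycle with prime length $p\le n-3$ (that is, the proportion of $g\in G$ such that, for some prime $p\le n-3$, some power of $g$ is a $p$-cycle). Then $$\rho_G\ \ge\ 1-\frac{(4.58\,\delta+0.17)\log\log n}{\log(n-3)},\qquad\text{where }\ \delta=\frac{n!}{|G|}\in\{1,2\}.$$
   Context: $\mathrm{S}_n$ and $\mathrm{A}_n$ denote the symmetric and alternating groups of degree $n$, where $n$ is an integer. All logarithms are natural and $\log\log n=\log(\log n)$. A $p$-cycle is a permutation having exactly one cycle of length greater than $1$ in its disjoint cycle decomposition, that cycle having length $p$. The proportion of elements of $G$ with a property is the number of such elements divided by $|G|$. *)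

theory Defs
  imports
    Complex_Main
    "HOL-Algebra.Sym_Groups"
    "HOL-Combinatorics.Orbits"
    "HOL-Computational_Algebra.Primes"
begin

text \<open>
  The supports of the cycles of \<open>g\<close> are its orbits; fixed points are the orbits of size 1.
  For a permutation of finite support every orbit is finite, so \<open>card\<close> is the true length.
\<close>

definition is_cycle_of_length :: "nat \<Rightarrow> ('a \<Rightarrow> 'a) \<Rightarrow> bool" where
  "is_cycle_of_length l g \<longleftrightarrow>
     permutation g \<and> (\<exists>C. {orbit g x | x. card (orbit g x) > 1} = {C} \<and> card C = l)"

definition powers_to_cycle :: "nat \<Rightarrow> ('a \<Rightarrow> 'a) \<Rightarrow> bool" where
  "powers_to_cycle l g \<longleftrightarrow> (\<exists>k::nat. is_cycle_of_length l (g ^^ k))"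

definition proportion :: "'b set \<Rightarrow> ('b \<Rightarrow> bool) \<Rightarrow> real" where
  "proportion G P = real (card {g \<in> G. P g}) / real (card G)"

end

theory Submission
  imports Defs "HOL-Analysis.Harmonic_Numbers" "HOL-Number_Theory.Cong"
begin

text \<open>
  Let \<open>g\<close> permute \<open>n\<close> points and let \<open>q \<ge> 4\<close>. If some prime \<open>p\<close> with \<open>q \<le> p \<le> n - 3\<close> is the length of a
  cycle of \<open>g\<close> and divides the length of no other cycle, then raising \<open>g\<close> to the product of the
  orbit sizes of the remaining points leaves a \<open>p\<close>-cycle (\<open>powers_to_cycle_prime\<close>). Hence a
  permutation without such a power either has no cycle whose length is a prime in
  \<open>[q, n - 3]\<close>, or has, for some such prime \<open>p\<close>, a \<open>p\<close>-cycle together with a second cycle of length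
  divisible by \<open>p\<close> (\<open>card_not_powering_le\<close>).

  The proportion \<open>u(n)\<close> of permutations that avoid a set \<open>C\<close> of cycle lengths satisfies
  \<open>n * u(n) = (\<Sum>j. u(n - j))\<close>, summed over the admissible lengths \<open>j\<close> of the cycle through a fixed
  point. Thus \<open>n * u(n)\<close> is at most \<open>\<Sum>i<n. u(i)\<close>, and a generating function argument bounds this
  sum by \<open>exp(H(n - 1) - (\<Sum>p\<in>C. 1/p))\<close> with \<open>H\<close> the harmonic numbers. Therefore
  \<open>u(n) \<le> exp(\<gamma> - (\<Sum>p\<in>C. 1/p))\<close>, \<open>\<gamma>\<close> being the Euler-Mascheroni constant
  (\<open>cycle_prob_avoiding_le\<close>). The expected number of pairs consisting of a \<open>p\<close>-cycle and another cycle of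
  length divisible by \<open>p\<close> is at most \<open>H(n div p) / p\<^sup>2\<close> (\<open>card_permutes_with_two_cycles_le\<close>), so the
  second possibility contributes at most about \<open>ln n / (2 * q)\<close>.

  Mertens' theorem gives \<open>\<Sum>p\<in>C. 1/p \<approx> ln (ln n / ln q)\<close>, so the first contribution is about
  \<open>exp \<gamma> * ln q / ln n\<close>. The second is smaller than this as soon as \<open>q\<close> is of order \<open>(ln n)\<^sup>2\<close>, and
  \<open>ln q \<approx> 2 * ln (ln n)\<close> then produces the shape of the bound. What remains is to make Mertens' theorem
  explicit. Only lower bounds of \<open>\<Sum>p\<in>C. 1/p\<close> matter; they follow by Abel summation from a lower bound of
  \<open>\<Sum>p\<le>t. ln p / (p - 1)\<close> for all \<open>t\<close>, which is immediate from the factorisation of \<open>t!\<close>, and from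
  an upper bound at the single point \<open>t = q - 1\<close>, which rests on Chebyshev's estimate
  \<open>\<Sum>p\<le>t. ln p \<le> t * ln 4\<close> or, for \<open>q = 64\<close>, on direct computation (\<open>sum_reciprocals_primes_ge\<close>, \<open>mertens_sum_upper\<close>). With \<open>L = ln n\<close>, the choice
  \<open>q = 64\<close> for \<open>L \<le> 26\<close> and \<open>q = \<lfloor>L\<^sup>2 / 3\<rfloor>\<close> for larger \<open>L\<close> shows that at most the fraction
  \<open>4.665 * ln L / ln (n - 3)\<close>, where \<open>4.665 = 933 / 200\<close>, of the symmetric group lacks the required power.

  Finally, a subgroup of index \<open>\<delta>\<close> contains at most all of these permutations, so their proportion
  grows by a factor of at most \<open>\<delta>\<close>; and \<open>4.665 * \<delta> \<le> 4.58 * \<delta> + 0.17\<close> for \<open>\<delta> \<in> {1, 2}\<close>, with equality for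
  \<open>\<delta> = 2\<close>.
\<close>

section \<open>Splitting a permutation along a cycle\<close>

lemma orbit_perm_restrict:
  assumes g: "g permutes S" "cyclic_on g T" and y: "y \<in> S - T"
  shows "orbit (perm_restrict g (S - T)) y = orbit g y"
proof (rule orbit_cong0[symmetric])
  show "g \<in> S - T \<rightarrow> S - T"
    using permutes_in_image[OF g(1)] cyclic_on_f_in[OF g] by auto
qed (use y in \<open>auto simp: perm_restrict_simps\<close>)

text \<open>
  A cycle and its complement are both invariant, so restricting to them loses nothing. This
  product decomposition turns every count below into a product of smaller counts.
\<close>

lemma bij_betw_split_off_cycle:
  assumes "finite S" "T \<subseteq> S"
  shows "bij_betw (\<lambda>g. (perm_restrict g T, perm_restrict g (S - T)))
     {g. g permutes S \<and> cyclic_on g T}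
     ({c. c permutes T \<and> cyclic_on c T} \<times> {h. h permutes (S - T)})"
proof (rule bij_betw_byWitness[where f' = "\<lambda>(c, h). c \<circ> h"])
  have perm: "perm_restrict g T permutes T" if g: "g permutes S" "cyclic_on g T" for g
  proof -
    have "bij_betw g T T"
    proof -
      have "g ` T \<subseteq> T" using g cyclic_on_inI by fast
      moreover have "inj_on g T" using g(1) permutes_inj_on by blast
      ultimately show ?thesis
        using assms finite_subset[OF assms(2,1)] by (simp add: bij_betw_def endo_inj_surj)
    qed
    then have "bij_betw (perm_restrict g T) T T"
      by (subst bij_betw_cong[of _ _ g]) (auto simp: perm_restrict_simps)
    then show ?thesis by (rule bij_imp_permutes) (auto simp: perm_restrict_simps)
  qed
  show "\<forall>g\<in>{g. g permutes S \<and> cyclic_on g T}.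
      (case (perm_restrict g T, perm_restrict g (S - T)) of (c, h) \<Rightarrow> c \<circ> h) = g"
  proof safe
    fix g assume g: "g permutes S" "cyclic_on g T"
    have "perm_restrict g T \<circ> perm_restrict g (S - T) = perm_restrict g (T \<union> (S - T))"
      by (rule perm_restrict_union) (use perm perm_restrict_diff_cyclic g in auto)
    then show "perm_restrict g T \<circ> perm_restrict g (S - T) = g"
      using assms g by (simp add: Un_absorb1)
  qed
  show "(\<lambda>g. (perm_restrict g T, perm_restrict g (S - T))) ` {g. g permutes S \<and> cyclic_on g T}
      \<subseteq> {c. c permutes T \<and> cyclic_on c T} \<times> {h. h permutes (S - T)}"
    using perm perm_restrict_diff_cyclic by (auto simp: cyclic_on_perm_restrict)
  show "\<forall>p\<in>{c. c permutes T \<and> cyclic_on c T} \<times> {h. h permutes (S - T)}.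
      (perm_restrict (case p of (c, h) \<Rightarrow> c \<circ> h) T, perm_restrict (case p of (c, h) \<Rightarrow> c \<circ> h) (S - T)) = p"
  proof
    fix p assume "p \<in> {c. c permutes T \<and> cyclic_on c T} \<times> {h. h permutes (S - T)}"
    then obtain c h where p: "p = (c, h)" and c: "c permutes T" and h: "h permutes (S - T)"
      by auto
    have 1: "c (h x) = c x" if "x \<in> T" for x
      using that permutes_not_in[OF h, of x] by simp
    have 2: "c (h x) = h x" if "x \<in> S - T" for x
      using permutes_in_image[OF h, of x] that permutes_not_in[OF c, of "h x"] by auto
    show "(perm_restrict (case p of (c, h) \<Rightarrow> c \<circ> h) T,
        perm_restrict (case p of (c, h) \<Rightarrow> c \<circ> h) (S - T)) = p"
    proof -
      have "perm_restrict (c \<circ> h) T = c"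
        using 1 permutes_not_in[OF c] by (auto simp: perm_restrict_def)
      moreover have "perm_restrict (c \<circ> h) (S - T) = h"
      proof
        fix x show "perm_restrict (c \<circ> h) (S - T) x = h x"
          using 2[of x] permutes_not_in[OF h, of x] by (simp add: perm_restrict_def)
      qed
      ultimately show ?thesis by (simp add: p)
    qed
  qed
  show "(\<lambda>(c, h). c \<circ> h) ` ({c. c permutes T \<and> cyclic_on c T} \<times> {h. h permutes (S - T)})
      \<subseteq> {g. g permutes S \<and> cyclic_on g T}"
  proof safe
    fix c h assume c: "c permutes T" "cyclic_on c T" and h: "h permutes (S - T)"
    show "c \<circ> h permutes S"
      by (rule permutes_compose[OF permutes_subset[OF h] permutes_subset[OF c(1) assms(2)]]) auto
    show "cyclic_on (c \<circ> h) T"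
      by (rule permutes_comp_preserves_cyclic1[OF h c(2), of T]) auto
  qed
qed

lemma card_split_off_cycle:
  assumes "finite S" "T \<subseteq> S"
  shows "card {g. g permutes S \<and> cyclic_on g T \<and> P (perm_restrict g (S - T))} =
     card {c. c permutes T \<and> cyclic_on c T} * card {h. h permutes (S - T) \<and> P h}"
proof -
  let ?F = "\<lambda>g. (perm_restrict g T, perm_restrict g (S - T))"
  note b = bij_betw_split_off_cycle[OF assms]
  have "bij_betw ?F {g. g permutes S \<and> cyclic_on g T \<and> P (perm_restrict g (S - T))}
      ({c. c permutes T \<and> cyclic_on c T} \<times> {h. h permutes (S - T) \<and> P h})"
    unfolding bij_betw_def
  proof
    show "inj_on ?F {g. g permutes S \<and> cyclic_on g T \<and> P (perm_restrict g (S - T))}"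
      using b unfolding bij_betw_def by (auto elim: inj_on_subset)
    have im: "?F ` {g. g permutes S \<and> cyclic_on g T} =
        {c. c permutes T \<and> cyclic_on c T} \<times> {h. h permutes (S - T)}"
      using b by (simp add: bij_betw_def)
    have "?F ` {g. g permutes S \<and> cyclic_on g T \<and> P (perm_restrict g (S - T))} =
        {z \<in> ?F ` {g. g permutes S \<and> cyclic_on g T}. P (snd z)}" by auto
    then show "?F ` {g. g permutes S \<and> cyclic_on g T \<and> P (perm_restrict g (S - T))} =
        {c. c permutes T \<and> cyclic_on c T} \<times> {h. h permutes (S - T) \<and> P h}"
      unfolding im by auto
  qed
  then show ?thesis by (simp add: bij_betw_same_card card_cartesian_product)
qed

lemma cyclic_on_orbit_iff:
  assumes "g permutes S" "finite S" "x \<in> S"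
  shows "T = orbit g x \<longleftrightarrow> T \<subseteq> S \<and> x \<in> T \<and> cyclic_on g T"
proof -
  have "permutation g" using assms by (auto simp: permutation_permutes)
  then show ?thesis
    using permutes_orbit_subset[OF assms(1,3)] cyclic_on_orbit'[of g x]
      permutation_self_in_orbit[of g x] orbit_cyclic_eq3[of g T x] by blast
qed

lemma sum_over_subsets_containing:
  assumes "finite S" "x \<in> S"
  shows "(\<Sum>T\<in>{T. T \<subseteq> S \<and> x \<in> T}. f (card T)) =
    (\<Sum>j=1..card S. of_nat ((card S - 1) choose (j - 1)) * (f j :: 'a :: semiring_1))"
proof -
  have "(\<Sum>T\<in>{T. T \<subseteq> S \<and> x \<in> T}. f (card T)) = (\<Sum>U\<in>Pow (S - {x}). f (Suc (card U)))"
  proof (rule sum.reindex_bij_witness[of _ "insert x" "\<lambda>T. T - {x}"])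
    fix T assume "T \<in> {T. T \<subseteq> S \<and> x \<in> T}"
    then have "card (T - {x}) = card T - 1" "card T > 0"
      using assms finite_subset by (auto simp: card_gt_0_iff)
    then show "f (Suc (card (T - {x}))) = f (card T)" by simp
  qed (use assms in auto)
  also have "\<dots> = (\<Sum>i\<le>card (S - {x}). \<Sum>U\<in>{U \<in> Pow (S - {x}). card U = i}. f (Suc (card U)))"
    using assms by (intro sum.group[symmetric]) (auto intro!: card_mono simp del: card_Diff_insert)
  also have "\<dots> = (\<Sum>i\<le>card S - 1. of_nat ((card S - 1) choose i) * f (Suc i))"
  proof (rule sum.cong)
    show "{..card (S - {x})} = {..card S - 1}" using assms by simp
    fix i
    have "(\<Sum>U\<in>{U \<in> Pow (S - {x}). card U = i}. f (Suc (card U))) =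
       (\<Sum>U\<in>{U. U \<subseteq> S - {x} \<and> card U = i}. f (Suc i))"
      by (rule sum.cong) auto
    also have "\<dots> = of_nat (card {U. U \<subseteq> S - {x} \<and> card U = i}) * f (Suc i)" by simp
    finally show "(\<Sum>U\<in>{U \<in> Pow (S - {x}). card U = i}. f (Suc (card U))) =
        of_nat ((card S - 1) choose i) * f (Suc i)"
      using assms n_subsets[of "S - {x}" i] by simp
  qed
  also have "\<dots> = (\<Sum>j=1..card S. of_nat ((card S - 1) choose (j - 1)) * f j)"
  proof (rule sum.reindex_bij_witness[of _ "\<lambda>j. j - 1" Suc])
    have "card S > 0" using assms by (auto simp: card_gt_0_iff)
    then show "Suc i \<in> {1..card S}" if "i \<in> {..card S - 1}" for i using that by auto
  qed auto
  finally show ?thesis .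
qed

text \<open>
  Conditioning on the orbit of a fixed point \<open>x\<close> classifies each permutation exactly once, which
  gives the recursions below.
\<close>

lemma card_permutes_by_orbit:
  assumes "finite S" "x \<in> S"
  shows "card {g. g permutes S \<and> P (orbit g x) (perm_restrict g (S - orbit g x))} =
    (\<Sum>T\<in>{T. T \<subseteq> S \<and> x \<in> T}.
       card {c. c permutes T \<and> cyclic_on c T} * card {h. h permutes (S - T) \<and> P T h})"
proof -
  let ?A = "\<lambda>T. {g. g permutes S \<and> cyclic_on g T \<and> P T (perm_restrict g (S - T))}"
  have "{g. g permutes S \<and> P (orbit g x) (perm_restrict g (S - orbit g x))} =
      (\<Union>T\<in>{T. T \<subseteq> S \<and> x \<in> T}. ?A T)"
  proof (intro Set.set_eqI iffI)
    fix g assume "g \<in> {g. g permutes S \<and> P (orbit g x) (perm_restrict g (S - orbit g x))}"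
    then show "g \<in> (\<Union>T\<in>{T. T \<subseteq> S \<and> x \<in> T}. ?A T)"
      using cyclic_on_orbit_iff[OF _ assms, of g "orbit g x"] by auto
  next
    fix g assume "g \<in> (\<Union>T\<in>{T. T \<subseteq> S \<and> x \<in> T}. ?A T)"
    then obtain T where T: "T \<subseteq> S" "x \<in> T" "g \<in> ?A T" by auto
    then have "orbit g x = T" by (intro orbit_cyclic_eq3) auto
    then show "g \<in> {g. g permutes S \<and> P (orbit g x) (perm_restrict g (S - orbit g x))}"
      using T by simp
  qed
  also have "card \<dots> = (\<Sum>T\<in>{T. T \<subseteq> S \<and> x \<in> T}. card (?A T))"
  proof (rule card_UN_disjoint)
    show "\<forall>T\<in>{T. T \<subseteq> S \<and> x \<in> T}. finite (?A T)"
      using finite_permutations[OF assms(1)] by auto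
    show "\<forall>T\<in>{T. T \<subseteq> S \<and> x \<in> T}. \<forall>T'\<in>{T. T \<subseteq> S \<and> x \<in> T}. T \<noteq> T' \<longrightarrow> ?A T \<inter> ?A T' = {}"
      using orbit_cyclic_eq3[of _ _ x] by (auto, metis+)
  qed (use assms in simp)
  also have "\<dots> = (\<Sum>T\<in>{T. T \<subseteq> S \<and> x \<in> T}.
       card {c. c permutes T \<and> cyclic_on c T} * card {h. h permutes (S - T) \<and> P T h})"
    by (rule sum.cong) (use card_split_off_cycle[OF assms(1)] in auto)
  finally show ?thesis .
qed

lemma binomial_fact_cancel:
  assumes "1 \<le> j" "j \<le> n"
  shows "real ((n - 1) choose (j - 1)) * (fact (j - 1) * fact (n - j)) = fact (n - 1)"
proof -
  have "(fact (j - 1) * fact (n - 1 - (j - 1)) * ((n - 1) choose (j - 1)) :: nat) = fact (n - 1)"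
    by (rule binomial_fact_lemma) (use assms in auto)
  then have "(fact (j - 1) * fact (n - j) * ((n - 1) choose (j - 1)) :: nat) = fact (n - 1)"
    using assms by simp
  then have "real (fact (j - 1) * fact (n - j) * ((n - 1) choose (j - 1))) = fact (n - 1)"
    by (metis of_nat_fact)
  then show ?thesis by (simp add: algebra_simps)
qed

text \<open>
  The number of cyclic arrangements is read off from the total count \<open>n!\<close>: classified by the
  orbit of a point, the permutations whose orbit has a given size \<open>j < n\<close> number \<open>(n - 1)!\<close> by
  induction, and what remains for \<open>j = n\<close> is \<open>n! - (n - 1) * (n - 1)! = (n - 1)!\<close>.
\<close>

lemma card_cyclic_permutations:
  assumes "finite T" "T \<noteq> {}"
  shows "real (card {c. c permutes T \<and> cyclic_on c T}) = fact (card T - 1)"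
  using assms
proof (induction T rule: finite_psubset_induct)
  case (psubset S)
  then obtain x where x: "x \<in> S" by blast
  let ?c = "\<lambda>T. real (card {c. c permutes T \<and> cyclic_on c T})"
  let ?n = "card S"
  let ?f = "\<lambda>j. fact (j - 1) * fact (?n - j) :: real"
  have n: "?n > 0" using psubset x by (auto simp: card_gt_0_iff)
  have fin: "finite {T. T \<subseteq> S \<and> x \<in> T}" using psubset by simp
  have "fact ?n = real (card {g. g permutes S \<and> True})"
    using card_permutations[OF refl psubset(1)] by simp
  also have "\<dots> = (\<Sum>T\<in>{T. T \<subseteq> S \<and> x \<in> T}. ?c T * card {h. h permutes (S - T) \<and> True})"
    using card_permutes_by_orbit[OF psubset(1) x, where P = "\<lambda>_ _. True"] by simp
  also have "\<dots> = (\<Sum>T\<in>{T. T \<subseteq> S \<and> x \<in> T}. ?c T * fact (?n - card T))"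
  proof (rule sum.cong)
    fix T assume "T \<in> {T. T \<subseteq> S \<and> x \<in> T}"
    then have "card (S - T) = ?n - card T"
      using psubset(1) by (intro card_Diff_subset) (auto intro: finite_subset)
    then show "?c T * card {h. h permutes (S - T) \<and> True} = ?c T * fact (?n - card T)"
      using card_permutations[OF refl, of "S - T"] psubset(1) by simp
  qed simp
  also have "\<dots> = ?c S + (\<Sum>T\<in>{T. T \<subseteq> S \<and> x \<in> T} - {S}. ?c T * fact (?n - card T))"
    using fin x by (subst sum.remove[of _ S]) auto
  also have "(\<Sum>T\<in>{T. T \<subseteq> S \<and> x \<in> T} - {S}. ?c T * fact (?n - card T)) =
      (\<Sum>T\<in>{T. T \<subseteq> S \<and> x \<in> T} - {S}. ?f (card T))"
    using psubset.IH by (intro sum.cong) (auto simp: psubset_eq)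
  also have "\<dots> = (\<Sum>T\<in>{T. T \<subseteq> S \<and> x \<in> T}. ?f (card T)) - ?f ?n"
    using fin x by (subst sum_diff1) auto
  also have "(\<Sum>T\<in>{T. T \<subseteq> S \<and> x \<in> T}. ?f (card T)) =
     (\<Sum>j=1..?n. of_nat ((?n - 1) choose (j - 1)) * ?f j)"
    by (rule sum_over_subsets_containing[OF psubset(1) x])
  also have "\<dots> = (\<Sum>j=1..?n. fact (?n - 1))"
    by (rule sum.cong) (use binomial_fact_cancel in auto)
  also have "\<dots> = fact ?n" using n fact_reduce[of ?n, where 'a=real] by simp
  finally show ?case by simp
qed

section \<open>Permutations with restricted cycle lengths\<close>

text \<open>
  The probability that all cycle lengths of a uniformly random permutation of \<open>n\<close> points lie in
  \<open>A\<close>. The recursion conditions on the length of the cycle through a fixed point, which is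
  uniformly distributed on \<open>{1..n}\<close>.
\<close>

fun cycle_prob :: "nat set \<Rightarrow> nat \<Rightarrow> real" where
  "cycle_prob A n = (if n = 0 then 1 else (\<Sum>j\<in>A \<inter> {1..n}. cycle_prob A (n - j)) / n)"

declare cycle_prob.simps [simp del]

lemma cycle_prob_nonneg: "cycle_prob A n \<ge> 0"
proof (induction n rule: less_induct)
  case (less n)
  then show ?case by (subst cycle_prob.simps) (auto intro!: sum_nonneg divide_nonneg_nonneg)
qed

lemma card_permutes_cycle_lengths:
  assumes "finite S"
  shows "real (card {g. g permutes S \<and> (\<forall>y\<in>S. card (orbit g y) \<in> A)}) =
    fact (card S) * cycle_prob A (card S)"
  using assms
proof (induction S rule: finite_psubset_induct)
  case (psubset S)
  show ?case
  proof (cases "S = {}")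
    case True
    then show ?thesis by (simp add: cycle_prob.simps)
  next
    case False
    then obtain x where x: "x \<in> S" by blast
    let ?n = "card S"
    have n: "?n > 0" using psubset x by (auto simp: card_gt_0_iff)
    let ?P = "\<lambda>T h. card T \<in> A \<and> (\<forall>y\<in>S - T. card (orbit h y) \<in> A)"
    let ?f = "\<lambda>j. if j \<in> A then fact (j - 1) * (fact (?n - j) * cycle_prob A (?n - j)) else 0"
    have "{g. g permutes S \<and> (\<forall>y\<in>S. card (orbit g y) \<in> A)} =
       {g. g permutes S \<and> ?P (orbit g x) (perm_restrict g (S - orbit g x))}"
    proof (intro Collect_cong conj_cong refl)
      fix g assume g: "g permutes S"
      have c: "cyclic_on g (orbit g x)" by (rule cyclic_on_orbit[OF g psubset(1)])
      have "x \<in> orbit g x"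
        using g psubset(1) by (intro permutation_self_in_orbit) (auto simp: permutation_permutes)
      then have "(\<forall>y\<in>S. card (orbit g y) \<in> A) \<longleftrightarrow>
          card (orbit g x) \<in> A \<and> (\<forall>y\<in>S - orbit g x. card (orbit g y) \<in> A)"
        using x orbit_cyclic_eq3[OF c] by (metis DiffD1 DiffI)
      also have "\<dots> \<longleftrightarrow> ?P (orbit g x) (perm_restrict g (S - orbit g x))"
        using orbit_perm_restrict[OF g c] by (intro conj_cong ball_cong) simp_all
      finally show "(\<forall>y\<in>S. card (orbit g y) \<in> A) \<longleftrightarrow>
          ?P (orbit g x) (perm_restrict g (S - orbit g x))" .
    qed
    then have "real (card {g. g permutes S \<and> (\<forall>y\<in>S. card (orbit g y) \<in> A)}) =
       (\<Sum>T\<in>{T. T \<subseteq> S \<and> x \<in> T}. real (card {c. c permutes T \<and> cyclic_on c T})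
          * real (card {h. h permutes (S - T) \<and> ?P T h}))"
      using card_permutes_by_orbit[OF psubset(1) x, of ?P] by simp
    also have "\<dots> = (\<Sum>T\<in>{T. T \<subseteq> S \<and> x \<in> T}. ?f (card T))"
    proof (rule sum.cong)
      fix T assume "T \<in> {T. T \<subseteq> S \<and> x \<in> T}"
      then have T: "T \<subseteq> S" "x \<in> T" "finite T" using psubset(1) finite_subset by auto
      have "card (S - T) = ?n - card T" using T by (intro card_Diff_subset) auto
      moreover have "real (card {h. h permutes (S - T) \<and> (\<forall>y\<in>S - T. card (orbit h y) \<in> A)})
          = fact (card (S - T)) * cycle_prob A (card (S - T))"
        using T by (intro psubset.IH) auto
      ultimately show "real (card {c. c permutes T \<and> cyclic_on c T})
          * real (card {h. h permutes (S - T) \<and> ?P T h}) = ?f (card T)"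
        using card_cyclic_permutations[of T] T by auto
    qed simp
    also have "\<dots> = (\<Sum>j=1..?n. real ((?n - 1) choose (j - 1)) * ?f j)"
      by (rule sum_over_subsets_containing[OF psubset(1) x])
    also have "\<dots> = (\<Sum>j=1..?n. if j \<in> A then fact (?n - 1) * cycle_prob A (?n - j) else 0)"
    proof (rule sum.cong)
      fix j assume "j \<in> {1..?n}"
      then show "real ((?n - 1) choose (j - 1)) * ?f j =
          (if j \<in> A then fact (?n - 1) * cycle_prob A (?n - j) else 0)"
        using binomial_fact_cancel[of j ?n] by (simp flip: mult.assoc)
    qed simp
    also have "\<dots> = (\<Sum>j\<in>A \<inter> {1..?n}. fact (?n - 1) * cycle_prob A (?n - j))"
      by (subst Int_commute, rule sum.inter_restrict[symmetric]) simp
    also have "\<dots> = fact (?n - 1) * (\<Sum>j\<in>A \<inter> {1..?n}. cycle_prob A (?n - j))"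
      by (rule sum_distrib_left[symmetric])
    also have "\<dots> = fact ?n * cycle_prob A ?n"
      using n fact_reduce[of ?n, where 'a = real] cycle_prob.simps[of A ?n] by simp
    finally show ?thesis .
  qed
qed

text \<open>
  The truncated generating function \<open>f x = (\<Sum>i\<le>N. u i * x ^ i)\<close> satisfies
  \<open>f' x \<le> f x * (\<Sum>j\<in>A \<inter> {1..N}. x ^ (j - 1))\<close> on \<open>[0, 1]\<close>, because all its coefficients are nonnegative and
  the recursion expresses \<open>i * u i\<close> through earlier ones. Integrating this inequality from \<open>0\<close> to
  \<open>1\<close> gives the claim.
\<close>

lemma sum_cycle_prob_le: "(\<Sum>i\<le>N. cycle_prob A i) \<le> exp (\<Sum>j\<in>A \<inter> {1..N}. 1 / real j)"
proof -
  let ?u = "cycle_prob A" and ?B = "A \<inter> {1..N}"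
  define f where "f = (\<lambda>x::real. \<Sum>i\<le>N. ?u i * x ^ i)"
  define f' where "f' = (\<lambda>x::real. \<Sum>i\<le>N. ?u i * (real i * x ^ (i - 1)))"
  define g where "g = (\<lambda>x::real. \<Sum>j\<in>?B. x ^ j / real j)"
  define g' where "g' = (\<lambda>x::real. \<Sum>j\<in>?B. x ^ (j - 1))"
  have df: "(f has_real_derivative f' x) (at x)" for x
    unfolding f_def f'_def by (auto intro!: derivative_eq_intros sum.cong)
  have dg: "(g has_real_derivative g' x) (at x)" for x
    unfolding g_def g'_def by (auto intro!: derivative_eq_intros sum.cong)
  have le: "f' x \<le> f x * g' x" if x: "0 \<le> x" for x
  proof -
    have "f' x = (\<Sum>i\<in>{1..N}. ?u i * (real i * x ^ (i - 1)))"
      unfolding f'_def by (rule sum.mono_neutral_right) (auto simp: not_le)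
    also have "\<dots> = (\<Sum>i\<in>{1..N}. \<Sum>j\<in>?B. if j \<le> i then ?u (i - j) * x ^ (i - j) * x ^ (j - 1) else 0)"
    proof (rule sum.cong)
      fix i assume i: "i \<in> {1..N}"
      have "?u i * real i = (\<Sum>j\<in>A \<inter> {1..i}. ?u (i - j))"
        using i cycle_prob.simps[of A i] by simp
      then have "?u i * (real i * x ^ (i - 1)) = (\<Sum>j\<in>A \<inter> {1..i}. ?u (i - j) * x ^ (i - 1))"
        by (simp add: sum_distrib_right flip: mult.assoc)
      also have "\<dots> = (\<Sum>j\<in>A \<inter> {1..i}. ?u (i - j) * x ^ (i - j) * x ^ (j - 1))"
      proof (rule sum.cong)
        fix j assume "j \<in> A \<inter> {1..i}"
        then have "i - 1 = (i - j) + (j - 1)" by auto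
        then show "?u (i - j) * x ^ (i - 1) = ?u (i - j) * x ^ (i - j) * x ^ (j - 1)"
          by (metis mult.assoc power_add)
      qed simp
      also have "\<dots> = (\<Sum>j\<in>?B. if j \<le> i then ?u (i - j) * x ^ (i - j) * x ^ (j - 1) else 0)"
        using i by (intro sum.mono_neutral_cong_left) auto
      finally show "?u i * (real i * x ^ (i - 1)) = \<dots>" .
    qed simp
    also have "\<dots> = (\<Sum>j\<in>?B. \<Sum>i\<in>{1..N}. if j \<le> i then ?u (i - j) * x ^ (i - j) * x ^ (j - 1) else 0)"
      by (rule sum.swap)
    also have "\<dots> \<le> (\<Sum>j\<in>?B. f x * x ^ (j - 1))"
    proof (rule sum_mono)
      fix j assume j: "j \<in> ?B"
      have "(\<Sum>i\<in>{1..N}. if j \<le> i then ?u (i - j) * x ^ (i - j) * x ^ (j - 1) else 0) =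
          (\<Sum>i\<in>{j..N}. ?u (i - j) * x ^ (i - j) * x ^ (j - 1))"
        using j by (intro sum.mono_neutral_cong_right) auto
      also have "\<dots> = (\<Sum>k\<in>{..N - j}. ?u k * x ^ k * x ^ (j - 1))"
        using j by (intro sum.reindex_bij_witness[of _ "\<lambda>k. k + j" "\<lambda>i. i - j"]) auto
      also have "\<dots> \<le> (\<Sum>k\<le>N. ?u k * x ^ k * x ^ (j - 1))"
        using x by (intro sum_mono2) (auto simp: cycle_prob_nonneg)
      also have "\<dots> = f x * x ^ (j - 1)" by (simp add: f_def sum_distrib_right)
      finally show "(\<Sum>i\<in>{1..N}. if j \<le> i then ?u (i - j) * x ^ (i - j) * x ^ (j - 1) else 0)
          \<le> f x * x ^ (j - 1)" .
    qed
    also have "\<dots> = f x * g' x" by (simp add: g'_def sum_distrib_left)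
    finally show ?thesis .
  qed
  have "f 1 * exp (- g 1) \<le> f 0 * exp (- g 0)"
  proof (rule DERIV_nonpos_imp_nonincreasing[where f = "\<lambda>x. f x * exp (- g x)"])
    fix x :: real assume x: "0 \<le> x" "x \<le> 1"
    have "((\<lambda>x. f x * exp (- g x)) has_real_derivative (f' x - f x * g' x) * exp (- g x)) (at x)"
      by (rule derivative_eq_intros df dg refl)+ (simp add: algebra_simps)
    moreover have "(f' x - f x * g' x) * exp (- g x) \<le> 0"
      using le[OF x(1)] by (intro mult_nonpos_nonneg) auto
    ultimately show "\<exists>y. ((\<lambda>x. f x * exp (- g x)) has_real_derivative y) (at x) \<and> y \<le> 0"
      by blast
  qed simp
  moreover have "f 0 = 1"
  proof -
    have "f 0 = (\<Sum>i\<in>{0}. ?u i * 0 ^ i)"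
      unfolding f_def by (intro sum.mono_neutral_right) auto
    then show ?thesis by (simp add: cycle_prob.simps)
  qed
  moreover have "g 0 = 0" unfolding g_def by (intro sum.neutral) auto
  ultimately have "f 1 * exp (- g 1) \<le> 1" by simp
  then have "f 1 \<le> exp (g 1)" by (simp add: exp_minus field_simps)
  then show ?thesis by (simp add: f_def g_def)
qed

text \<open>
  Dropping the condition on the length of the cycle through the distinguished point bounds
  \<open>n * u n\<close> by the sum of all earlier probabilities. The factor \<open>n\<close> then cancels against
  \<open>exp (harm (n - 1)) \<le> n * exp \<gamma>\<close>, where \<open>\<gamma> < 13 / 22\<close> is the Euler-Mascheroni constant.
\<close>

lemma cycle_prob_avoiding_le:
  assumes n: "n > 0" and C: "C \<subseteq> {1..n - 1}"
  shows "cycle_prob (- C) n \<le> exp (13 / 22 - (\<Sum>p\<in>C. 1 / real p))"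
proof -
  let ?u = "cycle_prob (- C)"
  have "real n * ?u n = (\<Sum>j\<in>- C \<inter> {1..n}. ?u (n - j))"
    using n by (subst cycle_prob.simps) simp
  also have "\<dots> \<le> (\<Sum>j\<in>{1..n}. ?u (n - j))"
    by (intro sum_mono2) (auto simp: cycle_prob_nonneg)
  also have "\<dots> = (\<Sum>i\<le>n - 1. ?u i)"
    using n by (intro sum.reindex_bij_witness[of _ "\<lambda>i. n - i" "\<lambda>j. n - j"]) auto
  also have "\<dots> \<le> exp (\<Sum>j\<in>- C \<inter> {1..n - 1}. 1 / real j)" by (rule sum_cycle_prob_le)
  also have "(\<Sum>j\<in>- C \<inter> {1..n - 1}. 1 / real j) = harm (n - 1) - (\<Sum>p\<in>C. 1 / real p)"
  proof -
    have "(\<Sum>j\<in>{1..n - 1} - C. 1 / real j) = (\<Sum>j\<in>{1..n - 1}. 1 / real j) - (\<Sum>p\<in>C. 1 / real p)"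
      by (rule sum_diff) (use C in auto)
    moreover have "- C \<inter> {1..n - 1} = {1..n - 1} - C" by auto
    ultimately show ?thesis by (simp add: harm_def inverse_eq_divide)
  qed
  also have "harm (n - 1) \<le> 13 / 22 + ln (real n)"
  proof (cases "n = 1")
    case False
    then have "n - 1 \<ge> 1" "real (Suc (n - 1)) = real n" using n by auto
    then have "harm (n - 1) - ln (real n) + inverse (real (2 * (n - 1 + 1))) \<le> euler_mascheroni"
      using euler_mascheroni_bounds[of "n - 1"] by (metis atLeastAtMost_iff)
    moreover have "(0::real) \<le> inverse (real (2 * (n - 1 + 1)))" by simp
    ultimately show ?thesis using euler_mascheroni_less_13_over_22 by linarith
  qed (simp add: harm_def)
  then have "exp (harm (n - 1) - (\<Sum>p\<in>C. 1 / real p)) \<le>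
      exp (ln (real n) + (13 / 22 - (\<Sum>p\<in>C. 1 / real p)))" by simp
  also have "\<dots> = real n * exp (13 / 22 - (\<Sum>p\<in>C. 1 / real p))"
    using n by (simp only: exp_add exp_ln of_nat_0_less_iff)
  finally show ?thesis using n by simp
qed

section \<open>Permutations with a prescribed pair of cycles\<close>

text \<open>
  A union bound over the possible cycles: there are \<open>(n choose j) * (j - 1)!\<close> cycles of length \<open>j\<close>,
  and \<open>(n choose j) * (j - 1)! * (n - j)! = n! / j\<close>. The predicate \<open>P\<close> about the rest of the
  permutation lets the bound be applied twice in a row.
\<close>

lemma card_permutes_with_cycle_le:
  assumes S: "finite S" and j: "j > 0" and r: "r \<ge> 0"
    and P: "\<And>T. T \<subseteq> S \<Longrightarrow> card T = j \<Longrightarrow>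
      real (card {h. h permutes (S - T) \<and> P T h}) \<le> fact (card S - j) * r"
  shows "real (card {g. g permutes S \<and>
      (\<exists>T\<subseteq>S. card T = j \<and> cyclic_on g T \<and> P T (perm_restrict g (S - T)))})
    \<le> fact (card S) * (r / j)"
proof (cases "j \<le> card S")
  case False
  then have "{g. g permutes S \<and>
      (\<exists>T\<subseteq>S. card T = j \<and> cyclic_on g T \<and> P T (perm_restrict g (S - T)))} = {}"
    using card_mono[OF S] by auto
  then show ?thesis using r by (metis card.empty divide_nonneg_nonneg fact_ge_zero mult_nonneg_nonneg of_nat_0 of_nat_0_le_iff)
next
  case True
  let ?n = "card S" and ?F = "{T. T \<subseteq> S \<and> card T = j}"
  let ?A = "\<lambda>T. {g. g permutes S \<and> cyclic_on g T \<and> P T (perm_restrict g (S - T))}"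
  have "{g. g permutes S \<and>
      (\<exists>T\<subseteq>S. card T = j \<and> cyclic_on g T \<and> P T (perm_restrict g (S - T)))} = (\<Union>T\<in>?F. ?A T)"
    by auto
  also have "real (card \<dots>) \<le> real (\<Sum>T\<in>?F. card (?A T))"
    using S by (intro of_nat_mono card_UN_le) auto
  also have "\<dots> \<le> (\<Sum>T\<in>?F. fact (j - 1) * (fact (?n - j) * r))"
    unfolding of_nat_sum
  proof (rule sum_mono)
    fix T assume "T \<in> ?F"
    then have T: "T \<subseteq> S" "card T = j" by auto
    have "real (card (?A T)) =
        real (card {c. c permutes T \<and> cyclic_on c T}) * card {h. h permutes (S - T) \<and> P T h}"
      by (subst card_split_off_cycle[OF S T(1)]) simp
    also have "real (card {c. c permutes T \<and> cyclic_on c T}) = fact (j - 1)"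
      using T j S finite_subset by (subst card_cyclic_permutations) auto
    finally show "real (card (?A T)) \<le> fact (j - 1) * (fact (?n - j) * r)"
      using P[OF T] by (simp add: mult_left_mono)
  qed
  also have "\<dots> = real (?n choose j) * fact (j - 1) * fact (?n - j) * r"
    using n_subsets[OF S, of j] by simp
  also have "real (?n choose j) * fact (j - 1) * fact (?n - j) = fact ?n / j"
  proof -
    have "real (?n choose j) = fact ?n / (fact j * fact (?n - j))"
      using True by (rule binomial_fact)
    moreover have "fact j = real j * fact (j - 1)" using j by (subst fact_reduce) auto
    ultimately show ?thesis by simp
  qed
  finally show ?thesis by simp
qed

lemma sum_inverse_multiples:
  assumes "p > 0"
  shows "(\<Sum>m\<in>{m\<in>{1..N}. p dvd m}. 1 / real m) = harm (N div p) / real p"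
proof -
  have "(\<Sum>m\<in>{m\<in>{1..N}. p dvd m}. 1 / real m) = (\<Sum>k\<in>{1..N div p}. inverse (real k) / real p)"
  proof (rule sum.reindex_bij_witness[of _ "\<lambda>k. p * k" "\<lambda>m. m div p"])
    fix m assume m: "m \<in> {m\<in>{1..N}. p dvd m}"
    then show "p * (m div p) = m" by simp
    show "m div p \<in> {1..N div p}"
      using m assms by (auto simp: div_le_mono Suc_le_eq div_greater_zero_iff dest: dvd_imp_le)
    show "inverse (real (m div p)) / real p = 1 / real m"
      using m assms by (auto simp: real_of_nat_div field_simps)
  next
    fix k assume k: "k \<in> {1..N div p}"
    then have "p * k \<le> p * (N div p)" by simp
    also have "\<dots> \<le> N" by simp
    finally show "p * k \<in> {m\<in>{1..N}. p dvd m}" using k assms by auto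
  qed (use assms in auto)
  then show ?thesis by (simp add: harm_def sum_divide_distrib)
qed

text \<open>
  The first cycle has length \<open>p\<close> and costs a factor \<open>1 / p\<close>; the second has length \<open>p * k\<close> and costs
  \<open>1 / (p * k)\<close>. Summing over \<open>k\<close> produces the harmonic number.
\<close>

lemma card_permutes_with_two_cycles_le:
  assumes S: "finite S" and p: "p > 0"
  shows "real (card {g. g permutes S \<and> (\<exists>T\<subseteq>S. card T = p \<and> cyclic_on g T \<and>
      (\<exists>U\<subseteq>S - T. p dvd card U \<and> cyclic_on (perm_restrict g (S - T)) U))})
    \<le> fact (card S) * (harm (card S div p) / (real p)\<^sup>2)"
proof -
  have "real (card {g. g permutes S \<and> (\<exists>T\<subseteq>S. card T = p \<and> cyclic_on g T \<and>
      (\<exists>U\<subseteq>S - T. p dvd card U \<and> cyclic_on (perm_restrict g (S - T)) U))})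
    \<le> fact (card S) * (harm (card S div p) / real p / p)"
  proof (rule card_permutes_with_cycle_le[OF S p])
    show "0 \<le> harm (card S div p) / real p" by (simp add: harm_nonneg)
    fix T assume T: "T \<subseteq> S" "card T = p"
    let ?R = "S - T"
    have R: "finite ?R" "card ?R = card S - p"
      using S T finite_subset by (auto intro: card_Diff_subset)
    let ?M = "{m\<in>{1..card ?R}. p dvd m}"
    have "{h. h permutes ?R \<and> (\<exists>U\<subseteq>?R. p dvd card U \<and> cyclic_on h U)} \<subseteq>
       (\<Union>m\<in>?M. {h. h permutes ?R \<and> (\<exists>U\<subseteq>?R. card U = m \<and> cyclic_on h U \<and> True)})"
    proof safe
      fix h U assume h: "h permutes ?R" and U: "U \<subseteq> ?R" "p dvd card U" "cyclic_on h U"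
      have "U \<noteq> {}" using U(3) by (auto simp: cyclic_on_def)
      then have "card U \<in> ?M"
        using U R card_mono[OF R(1) U(1)] finite_subset[OF U(1) R(1)]
        by (auto simp: Suc_le_eq card_gt_0_iff)
      then show "h \<in> (\<Union>m\<in>?M. {h. h permutes ?R \<and>
          (\<exists>U\<subseteq>?R. card U = m \<and> cyclic_on h U \<and> True)})"
        using h U by blast
    qed
    then have "card {h. h permutes ?R \<and> (\<exists>U\<subseteq>?R. p dvd card U \<and> cyclic_on h U)} \<le>
       card (\<Union>m\<in>?M. {h. h permutes ?R \<and> (\<exists>U\<subseteq>?R. card U = m \<and> cyclic_on h U \<and> True)})"
      using finite_permutations[OF R(1)] by (intro card_mono) auto
    also have "\<dots> \<le> (\<Sum>m\<in>?M. card {h. h permutes ?R \<and>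
        (\<exists>U\<subseteq>?R. card U = m \<and> cyclic_on h U \<and> True)})"
      by (rule card_UN_le) simp
    finally have "real (card {h. h permutes ?R \<and> (\<exists>U\<subseteq>?R. p dvd card U \<and> cyclic_on h U)}) \<le>
       (\<Sum>m\<in>?M. real (card {h. h permutes ?R \<and>
        (\<exists>U\<subseteq>?R. card U = m \<and> cyclic_on h U \<and> True)}))"
      unfolding of_nat_sum[symmetric] of_nat_le_iff .
    also have "\<dots> \<le> (\<Sum>m\<in>?M. fact (card ?R) * (1 / real m))"
    proof (rule sum_mono)
      fix m assume "m \<in> ?M"
      then have m: "m > 0" by simp
      show "real (card {h. h permutes ?R \<and> (\<exists>U\<subseteq>?R. card U = m \<and> cyclic_on h U \<and> True)})
         \<le> fact (card ?R) * (1 / real m)"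
      proof (rule card_permutes_with_cycle_le[OF R(1) m, where P = "\<lambda>_ _. True"])
        fix V assume "V \<subseteq> ?R" "card V = m"
        then have "card (?R - V) = card ?R - m" using R(1) finite_subset by (auto intro: card_Diff_subset)
        then show "real (card {h. h permutes (?R - V) \<and> True}) \<le> fact (card ?R - m) * 1"
          using card_permutations[OF refl, of "?R - V"] R(1) by simp
      qed simp
    qed
    also have "\<dots> = fact (card ?R) * (harm (card ?R div p) / real p)"
      by (simp only: sum_distrib_left[symmetric] sum_inverse_multiples[OF p])
    also have "\<dots> \<le> fact (card ?R) * (harm (card S div p) / real p)"
      using R(2) by (intro mult_left_mono divide_right_mono harm_mono div_le_mono) auto
    finally show "real (card {h. h permutes ?R \<and> (\<exists>U\<subseteq>?R. p dvd card U \<and> cyclic_on h U)})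
       \<le> fact (card S - p) * (harm (card S div p) / real p)" by (simp add: R(2))
  qed
  then show ?thesis by (simp add: power2_eq_square)
qed

section \<open>Powers that are cycles of prime length\<close>

lemma funpow_card_orbit:
  assumes "permutation g"
  shows "(g ^^ card (orbit g x)) x = x"
proof -
  have self: "x \<in> orbit g x" by (rule permutation_self_in_orbit[OF assms])
  have "orbit g x = (\<lambda>n. (g ^^ n) x) ` {0..<funpow_dist1 g x x}"
    by (rule orbit_conv_funpow_dist1[OF self])
  then have "card (orbit g x) = funpow_dist1 g x x"
    using inj_on_funpow_dist1[OF self] by (simp add: card_image)
  then show ?thesis using funpow_dist1_prop[OF self] by simp
qed

lemma orbit_funpow_coprime:
  assumes g: "permutation g" and k: "coprime k (card (orbit g x))"
  shows "orbit (g ^^ k) x = orbit g x"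
proof -
  let ?p = "card (orbit g x)"
  have gk: "permutation (g ^^ k)"
    using g by (induction k) (auto simp: permutation_compose)
  obtain m where m: "[k * m = 1] (mod ?p)"
    using cong_solve_coprime_nat[OF k] by auto
  have "(g ^^ i) x \<in> orbit (g ^^ k) x" for i
  proof -
    have "[k * (m * i) = i] (mod ?p)"
      using cong_scalar_right[OF m, of i] by (simp add: mult_ac)
    then have "(g ^^ (k * (m * i))) x = (g ^^ i) x"
      using funpow_mod_eq[OF funpow_card_orbit[OF g, of x]] by (metis cong_def)
    then have "(g ^^ i) x = ((g ^^ k) ^^ (m * i)) x" by (simp add: funpow_mult)
    then show ?thesis unfolding orbit_altdef_permutation[OF gk] by blast
  qed
  moreover have "((g ^^ k) ^^ i) x \<in> orbit g x" for i
    unfolding orbit_altdef_permutation[OF g] by (auto simp: funpow_mult)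
  ultimately show ?thesis
    by (auto simp: orbit_altdef_permutation[OF g, of x] orbit_altdef_permutation[OF gk, of x])
qed

text \<open>
  Raising \<open>g\<close> to the product \<open>k\<close> of the orbit sizes outside \<open>T\<close> fixes every point outside \<open>T\<close>,
  while \<open>k\<close> is prime to \<open>p\<close>, so that \<open>g ^^ k\<close> is still transitive on \<open>T\<close>.
\<close>

lemma powers_to_cycle_prime:
  assumes g: "g permutes S" and S: "finite S" and T: "cyclic_on g T" "card T = p" "prime p"
    and others: "\<And>y. y \<in> S - T \<Longrightarrow> \<not> p dvd card (orbit g y)"
  shows "powers_to_cycle p g"
proof -
  have perm: "permutation g" using g S by (auto simp: permutation_permutes)
  define k where "k = (\<Prod>y\<in>S - T. card (orbit g y))"
  have gk: "permutation (g ^^ k)"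
    using perm by (induction k) (auto simp: permutation_compose)
  have "\<not> p dvd k"
    unfolding k_def using others S \<open>prime p\<close> by (subst prime_dvd_prod_iff) auto
  then have cop: "coprime k p" using \<open>prime p\<close> prime_imp_coprime coprime_commute by blast
  have in_T: "orbit (g ^^ k) x = T" if "x \<in> T" for x
    using orbit_funpow_coprime[OF perm, of k x] orbit_cyclic_eq3[OF T(1) that] cop T(2) by simp
  have out_T: "card (orbit (g ^^ k) y) = 1" if "y \<notin> T" for y
  proof -
    have "(g ^^ k) y = y"
    proof (cases "y \<in> S")
      case True
      then have "card (orbit g y) dvd k" using S that unfolding k_def by (intro dvd_prodI) auto
      then show ?thesis using funpow_mod_eq[OF funpow_card_orbit[OF perm, of y], of k] by simp
    next
      case False
      then have "g y = y" by (rule permutes_not_in[OF g])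
      then have "(g ^^ i) y = y" for i by (induction i) simp_all
      then show ?thesis .
    qed
    then show ?thesis using orbit_eq_singleton_iff[of "g ^^ k" y] by simp
  qed
  obtain x where x: "x \<in> T" using T(1) by (auto simp: cyclic_on_def)
  have "{orbit (g ^^ k) x |x. card (orbit (g ^^ k) x) > 1} = {T}"
  proof (intro subset_antisym subsetI)
    fix U assume "U \<in> {orbit (g ^^ k) x |x. card (orbit (g ^^ k) x) > 1}"
    then obtain x where "U = orbit (g ^^ k) x" "card (orbit (g ^^ k) x) > 1" by auto
    then show "U \<in> {T}" using in_T[of x] out_T[of x] by (cases "x \<in> T") simp_all
  next
    fix U assume "U \<in> {T}"
    then have "U = orbit (g ^^ k) x" "card (orbit (g ^^ k) x) > 1"
      using in_T[OF x] prime_gt_1_nat[OF \<open>prime p\<close>] T(2) by simp_all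
    then show "U \<in> {orbit (g ^^ k) x |x. card (orbit (g ^^ k) x) > 1}" by blast
  qed
  then show ?thesis
    unfolding powers_to_cycle_def is_cycle_of_length_def
    using gk T(2) by (intro exI[of _ k] conjI exI[of _ T])
qed
lemma card_not_powering_le:
  fixes n :: nat
  assumes n: "n > 0" and C: "C \<subseteq> {p. prime p \<and> p \<le> n - 3}"
  shows "real (card {g. g permutes {1..n} \<and>
      \<not> (\<exists>p. prime p \<and> p \<le> n - 3 \<and> powers_to_cycle p g)})
    \<le> fact n * (exp (13 / 22 - (\<Sum>p\<in>C. 1 / real p)) + (\<Sum>p\<in>C. harm (n div p) / (real p)\<^sup>2))"
proof -
  let ?S = "{1..n}"
  let ?N = "{g. g permutes ?S \<and> (\<forall>y\<in>?S. card (orbit g y) \<in> - C)}"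
  let ?E = "\<lambda>p. {g. g permutes ?S \<and> (\<exists>T\<subseteq>?S. card T = p \<and> cyclic_on g T \<and>
      (\<exists>U\<subseteq>?S - T. p dvd card U \<and> cyclic_on (perm_restrict g (?S - T)) U))}"
  have finC: "finite C" using C by (rule finite_subset) simp
  have "{g. g permutes ?S \<and> \<not> (\<exists>p. prime p \<and> p \<le> n - 3 \<and> powers_to_cycle p g)}
      \<subseteq> ?N \<union> (\<Union>p\<in>C. ?E p)"
  proof
    fix g assume "g \<in> {g. g permutes ?S \<and> \<not> (\<exists>p. prime p \<and> p \<le> n - 3 \<and> powers_to_cycle p g)}"
    then have g: "g permutes ?S" and no: "\<And>p. prime p \<Longrightarrow> p \<le> n - 3 \<Longrightarrow> \<not> powers_to_cycle p g"
      by auto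
    show "g \<in> ?N \<union> (\<Union>p\<in>C. ?E p)"
    proof (cases "\<forall>y\<in>?S. card (orbit g y) \<in> - C")
      case True
      then show ?thesis using g by simp
    next
      case False
      then obtain x where x: "x \<in> ?S" "card (orbit g x) \<in> C" by auto
      define T p where "T = orbit g x" and "p = card T"
      have T: "T \<subseteq> ?S" "cyclic_on g T"
        using permutes_orbit_subset[OF g x(1)] cyclic_on_orbit[OF g, of x] by (auto simp: T_def)
      have p: "p \<in> C" "prime p" "p \<le> n - 3" using x C by (auto simp: p_def T_def)
      then have "\<not> powers_to_cycle p g" by (intro no)
      then obtain y where y: "y \<in> ?S - T" "p dvd card (orbit g y)"
        using powers_to_cycle_prime[OF g _ T(2) p_def[symmetric] p(2)] by blast
      let ?h = "perm_restrict g (?S - T)"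
      have h: "?h permutes (?S - T)" by (rule perm_restrict_diff_cyclic[OF g T(2)])
      have "orbit ?h y \<subseteq> ?S - T" "cyclic_on ?h (orbit ?h y)"
        using permutes_orbit_subset[OF h y(1)] cyclic_on_orbit[OF h, of y] by auto
      moreover have "p dvd card (orbit ?h y)"
        using y orbit_perm_restrict[OF g T(2) y(1)] by simp
      ultimately have "g \<in> ?E p" using g T p_def by blast
      then show ?thesis using p(1) by blast
    qed
  qed
  then have "card {g. g permutes ?S \<and> \<not> (\<exists>p. prime p \<and> p \<le> n - 3 \<and> powers_to_cycle p g)}
      \<le> card (?N \<union> (\<Union>p\<in>C. ?E p))"
    using finC finite_permutations[of ?S] by (intro card_mono) auto
  also have "\<dots> \<le> card ?N + card (\<Union>p\<in>C. ?E p)" by (rule card_Un_le)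
  also have "\<dots> \<le> card ?N + (\<Sum>p\<in>C. card (?E p))"
    by (intro add_left_mono card_UN_le finC)
  finally have "real (card {g. g permutes ?S \<and> \<not> (\<exists>p. prime p \<and> p \<le> n - 3 \<and> powers_to_cycle p g)})
      \<le> real (card ?N) + (\<Sum>p\<in>C. real (card (?E p)))"
    unfolding of_nat_sum[symmetric] of_nat_add[symmetric] of_nat_le_iff .
  also have "real (card ?N) \<le> fact n * exp (13 / 22 - (\<Sum>p\<in>C. 1 / real p))"
  proof -
    have "C \<subseteq> {1..n - 1}"
    proof
      fix p assume "p \<in> C"
      then have "prime p" "p \<le> n - 3" using C by auto
      then show "p \<in> {1..n - 1}" using prime_ge_1_nat[of p] by simp
    qed
    then show ?thesis
      using card_permutes_cycle_lengths[of ?S "- C"] cycle_prob_avoiding_le[OF n, of C]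
      by (simp add: mult_left_mono)
  qed
  also have "(\<Sum>p\<in>C. real (card (?E p))) \<le> (\<Sum>p\<in>C. fact n * (harm (n div p) / (real p)\<^sup>2))"
  proof (rule sum_mono)
    fix p assume "p \<in> C"
    then have "p > 0" using C prime_gt_0_nat by auto
    then show "real (card (?E p)) \<le> fact n * (harm (n div p) / (real p)\<^sup>2)"
      using card_permutes_with_two_cycles_le[of ?S p] by simp
  qed
  finally show ?thesis by (simp add: sum_distrib_left algebra_simps)
qed

section \<open>Groups between the alternating and the symmetric group\<close>

text \<open>
  By Lagrange the index is a natural number, and it is at most \<open>2\<close> because \<open>G\<close> contains the
  alternating group, which has order \<open>n! / 2\<close>.
\<close>

lemma index_of_group_above_alternating:
  fixes n :: nat
  assumes n: "n \<ge> 2" and G: "subgroup G (sym_group n)" and A: "carrier (alt_group n) \<subseteq> G"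
  shows "fact n / real (card G) \<in> {1, 2}"
proof -
  interpret group "sym_group n" by (rule sym_group_is_group)
  let ?A = "carrier (alt_group n)"
  have fin: "finite (carrier (sym_group n))"
    by (simp add: sym_group_def finite_permutations)
  have sub: "G \<subseteq> carrier (sym_group n)" by (rule subgroup.subset[OF G])
  have finG: "finite G" using fin sub finite_subset by blast
  have two: "2 * card ?A = fact n" by (rule alt_group_card_carrier[OF n])
  have "card (rcosets\<^bsub>sym_group n\<^esub> G) * card G = order (sym_group n)"
    by (rule lagrange[OF G])
  then obtain k where k: "k * card G = fact n"
    by (simp add: order_def sym_group_card_carrier)
  have pos: "card G > 0" using k by (metis fact_nonzero mult_0_right neq0_conv)
  have "card ?A \<le> card G" by (rule card_mono[OF finG A])
  then have "k * card G \<le> 2 * card G" using k two by simp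
  then have "k \<le> 2" using pos by simp
  moreover have "k \<noteq> 0" using k by (metis fact_nonzero mult_0)
  ultimately have "k = 1 \<or> k = 2" by linarith
  moreover have "real k = fact n / real (card G)"
  proof -
    have "real k * real (card G) = fact n" using k by (metis of_nat_fact of_nat_mult)
    then show ?thesis using pos by (simp add: field_simps)
  qed
  ultimately show ?thesis by auto
qed

text \<open>
  The exceptional elements of \<open>G\<close> are among those of the whole symmetric group; dividing by the
  smaller order of \<open>G\<close> multiplies their proportion by the index.
\<close>

lemma proportion_subgroup_ge:
  fixes n :: nat
  assumes G: "subgroup G (sym_group n)"
    and bad: "real (card {g. g permutes {1..n} \<and> \<not> P g}) \<le> fact n * x"
  shows "proportion G P \<ge> 1 - fact n / real (card G) * x"
proof -
  have sub: "G \<subseteq> {g. g permutes {1..n}}"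
    using subgroup.subset[OF G] by (simp add: sym_group_def)
  have finG: "finite G" using sub finite_permutations[of "{1..n}"] finite_subset by blast
  have "G \<noteq> {}" using subgroup.one_closed[OF G] by blast
  then have pos: "real (card G) > 0" using finG by (simp add: card_gt_0_iff)
  have "card G = card {g \<in> G. P g} + card {g \<in> G. \<not> P g}"
    using finG by (subst card_Un_disjoint[symmetric]) (auto intro!: arg_cong[of _ _ card])
  moreover have "card {g \<in> G. \<not> P g} \<le> card {g. g permutes {1..n} \<and> \<not> P g}"
    using sub finite_permutations[of "{1..n}"] by (intro card_mono) auto
  ultimately have "real (card G) \<le> real (card {g \<in> G. P g}) + fact n * x"
    using bad by linarith
  then have "real (card G) / real (card G) \<le>
      (real (card {g \<in> G. P g}) + fact n * x) / real (card G)"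
    by (intro divide_right_mono) auto
  then show ?thesis
    using pos unfolding proportion_def by (simp add: add_divide_distrib)
qed

section \<open>Bounds of Chebyshev and Mertens\<close>

lemma prod_distinct_primes_dvd:
  fixes m :: nat
  assumes "finite P" "\<And>p. p \<in> P \<Longrightarrow> prime p" "\<And>p. p \<in> P \<Longrightarrow> p dvd m"
  shows "\<Prod>P dvd m"
  using assms
proof (induction P rule: finite_induct)
  case (insert p P)
  have "coprime p (\<Prod>P)"
    using insert by (intro prod_coprime_right) (metis insertCI primes_coprime)
  then show ?case using insert by (simp add: divides_mult)
qed simp

lemma choose_odd_middle_le: "(2 * m + 1) choose m \<le> 4 ^ m"
proof -
  have "2 * ((2 * m + 1) choose m) = (\<Sum>k\<in>{m, m + 1}. (2 * m + 1) choose k)"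
    using binomial_symmetric[of m "2 * m + 1"] by simp
  also have "\<dots> \<le> (\<Sum>k\<le>2 * m + 1. (2 * m + 1) choose k)"
    by (rule sum_mono2) auto
  also have "\<dots> = 2 ^ (2 * m + 1)" by (rule choose_row_sum)
  also have "\<dots> = 2 * 4 ^ m" by (simp add: power_mult)
  finally show ?thesis by simp
qed

text \<open>
  The argument of Erdos: the primes between \<open>m + 1\<close> and \<open>2 * m + 1\<close> all divide the binomial coefficient
  \<open>(2 * m + 1) choose m\<close>, which is at most \<open>4 ^ m\<close>.
\<close>

lemma primorial_le: "\<Prod>{p::nat. prime p \<and> p \<le> n} \<le> 4 ^ n"
proof (induction n rule: less_induct)
  case (less n)
  consider "n \<le> 2" | "n > 2" "even n" | m where "n = 2 * m + 1" "m \<ge> 1"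
  proof (cases "even n")
    case False
    then obtain m where "n = 2 * m + 1" by (elim oddE)
    then show ?thesis using that(1) that(3)[of m] by (cases "m = 0") auto
  qed (use that in fastforce)
  then show ?case
  proof cases
    case 1
    have "{p::nat. prime p \<and> p \<le> n} \<subseteq> {2}"
    proof
      fix p assume "p \<in> {p::nat. prime p \<and> p \<le> n}"
      then show "p \<in> {2}" using 1 prime_ge_2_nat[of p] by simp
    qed
    then consider "{p::nat. prime p \<and> p \<le> n} = {}" | "{p::nat. prime p \<and> p \<le> n} = {2}" by blast
    then show ?thesis
    proof cases
      assume eq: "{p::nat. prime p \<and> p \<le> n} = {2}"
      then have "2 \<in> {p::nat. prime p \<and> p \<le> n}" by simp
      then have "(4::nat) ^ 1 \<le> 4 ^ n" by (intro power_increasing) auto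
      then show ?thesis unfolding eq by simp
    next
      assume eq: "{p::nat. prime p \<and> p \<le> n} = {}"
      show ?thesis unfolding eq by simp
    qed
  next
    case 2
    have "\<not> prime n" using 2 prime_odd_nat[of n] by auto
    then have "p \<le> n \<longleftrightarrow> p \<le> n - 1" if "prime p" for p
      using that 2 by (cases "p = n") auto
    then have "{p::nat. prime p \<and> p \<le> n} = {p. prime p \<and> p \<le> n - 1}" by blast
    then have "\<Prod>{p. prime p \<and> p \<le> n} \<le> 4 ^ (n - 1)" using less.IH[of "n - 1"] 2 by simp
    also have "\<dots> \<le> 4 ^ n" by (intro power_increasing) auto
    finally show ?thesis .
  next
    case (3 m)
    let ?P = "{p. prime p \<and> m + 1 < p \<and> p \<le> 2 * m + 1}"
    have "{p. prime p \<and> p \<le> n} = {p. prime p \<and> p \<le> m + 1} \<union> ?P" using 3 by auto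
    then have "\<Prod>{p. prime p \<and> p \<le> n} = \<Prod>{p. prime p \<and> p \<le> m + 1} * \<Prod>?P"
      by (simp only:) (rule prod.union_disjoint, auto)
    moreover have "\<Prod>{p. prime p \<and> p \<le> m + 1} \<le> 4 ^ (m + 1)"
      using 3 by (intro less.IH) simp
    moreover have "\<Prod>?P \<le> 4 ^ m"
    proof -
      have "\<Prod>?P dvd (2 * m + 1) choose m"
      proof (rule prod_distinct_primes_dvd)
        fix p assume p: "p \<in> ?P"
        have p': "prime p" using p by simp
        have "p dvd fact (2 * m + 1)"
          using p unfolding prime_dvd_fact_iff[OF p'] by simp
        also have "(fact (2 * m + 1) :: nat) = fact m * fact (m + 1) * ((2 * m + 1) choose m)"
          using binomial_fact_lemma[of m "2 * m + 1"] by simp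
        finally show "p dvd (2 * m + 1) choose m"
          using p unfolding prime_dvd_mult_iff[OF p'] prime_dvd_fact_iff[OF p'] by auto
      qed auto
      then have "\<Prod>?P \<le> (2 * m + 1) choose m" by (rule dvd_imp_le) simp
      then show ?thesis using choose_odd_middle_le[of m] by linarith
    qed
    ultimately have "\<Prod>{p. prime p \<and> p \<le> n} \<le> 4 ^ (m + 1) * 4 ^ m"
      by (simp add: mult_le_mono)
    also have "\<dots> = 4 ^ n" using 3 by (simp flip: power_add)
    finally show ?thesis .
  qed
qed

lemma sum_ln_primes_le:
  fixes n :: nat
  shows "(\<Sum>p | prime p \<and> p \<le> n. ln (real p)) \<le> n * ln 4"
proof -
  have "(\<Sum>p | prime p \<and> p \<le> n. ln (real p)) = ln (\<Prod>p | prime p \<and> p \<le> n. real p)"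
    by (rule ln_prod[symmetric]) (auto simp: prime_gt_0_nat)
  also have "\<dots> = ln (real (\<Prod>{p. prime p \<and> p \<le> n}))" by simp
  also have "\<dots> \<le> ln (real (4 ^ n))"
    using primorial_le[of n]
    by (intro ln_mono) (auto simp: prod_pos prime_gt_0_nat simp del: of_nat_prod of_nat_power)
  finally show ?thesis by (simp add: ln_realpow)
qed

text \<open>
  Legendre's formula in recursive form: the multiples of \<open>p\<close> up to \<open>t\<close>, divided by \<open>p\<close>, are the
  numbers up to \<open>t div p\<close>.
\<close>

lemma multiplicity_fact_div:
  assumes p: "prime (p::nat)"
  shows "multiplicity p (fact t :: nat) = t div p + multiplicity p (fact (t div p) :: nat)"
proof (induction t)
  case (Suc t)
  have p2: "p \<ge> 2" using p by (rule prime_ge_2_nat)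
  have step: "multiplicity p (fact (Suc m) :: nat) = multiplicity p (Suc m) + multiplicity p (fact m :: nat)" for m
    using p by (simp add: prime_elem_multiplicity_mult_distrib del: of_nat_Suc mult_Suc)
  show ?case
  proof (cases "p dvd Suc t")
    case False
    then have "Suc t div p = t div p" by (simp add: div_Suc dvd_eq_mod_eq_0)
    then show ?thesis using Suc False by (simp only: step not_dvd_imp_multiplicity_0[OF False])
  next
    case True
    then obtain s where s: "Suc t = p * s" by (elim dvdE)
    then obtain r where r: "s = Suc r" by (cases s) auto
    have "Suc t div p = Suc r" using s r p2 by simp
    moreover have "t div p = r" using True calculation by (simp add: div_Suc dvd_eq_mod_eq_0)
    moreover have "multiplicity p (Suc t) = Suc (multiplicity p (Suc r))"
      using p s r p2 by (simp add: prime_elem_multiplicity_mult_distrib multiplicity_self del: mult_Suc_right)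
    ultimately show ?thesis using Suc by (simp only: step)
  qed
qed simp

lemma multiplicity_fact_upper:
  assumes p: "prime (p::nat)"
  shows "(p - 1) * multiplicity p (fact t :: nat) \<le> t"
proof (induction t rule: less_induct)
  case (less t)
  have p2: "p \<ge> 2" using p by (rule prime_ge_2_nat)
  show ?case
  proof (cases "t = 0")
    case False
    let ?s = "t div p"
    have "?s < t" using False p2 by (intro div_less_dividend) auto
    then have "(p - 1) * multiplicity p (fact t :: nat) \<le> (p - 1) * ?s + ?s"
      using less[of ?s] by (subst multiplicity_fact_div[OF p]) (simp add: distrib_left)
    also have "\<dots> = p * ?s" using p2 by (simp add: algebra_simps)
    also have "\<dots> \<le> t" by simp
    finally show ?thesis .
  qed simp
qed

text \<open>
  The exponent of \<open>p\<close> in \<open>t!\<close> is \<open>(t - s) / (p - 1)\<close> with \<open>s\<close> the digit sum of \<open>t\<close> in base \<open>p\<close>; the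
  loss is at most \<open>p - 1\<close> for each of the at most \<open>1 + ln t / ln p\<close> digits.
\<close>

lemma multiplicity_fact_lower:
  assumes p: "prime (p::nat)" and t: "t > 0"
  shows "real t * ln p \<le> (real p - 1) * (multiplicity p (fact t :: nat) * ln p + ln p + ln t)"
  using t
proof (induction t rule: less_induct)
  case (less t)
  have p2: "p \<ge> 2" using p by (rule prime_ge_2_nat)
  have lnp: "ln (real p) > 0" using p2 by simp
  let ?s = "t div p"
  let ?v = "\<lambda>t. real (multiplicity p (fact t :: nat))"
  show ?case
  proof (cases "?s = 0")
    case True
    then have "t < p" using p2 by (simp add: div_eq_0_iff)
    then have "real t \<le> real p - 1" by linarith
    then have "real t * ln p \<le> (real p - 1) * ln p" using lnp by (intro mult_right_mono) auto
    also have "\<dots> \<le> (real p - 1) * (?v t * ln p + ln p + ln t)"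
      using p2 less.prems lnp by (intro mult_left_mono) auto
    finally show ?thesis .
  next
    case False
    have "?s < t" using less.prems p2 by (intro div_less_dividend) auto
    then have IH: "real ?s * ln p \<le> (real p - 1) * (?v ?s * ln p + ln p + ln ?s)"
      using less.IH[of ?s] False by simp
    have "t mod p < p" using p2 by simp
    moreover have "t = p * ?s + t mod p" by simp
    ultimately have "t \<le> p * ?s + (p - 1)" by linarith
    then have "real t \<le> real (p * ?s + (p - 1))" by (rule of_nat_mono)
    also have "\<dots> = real p * ?s + (real p - 1)" using p2 by (simp add: of_nat_diff)
    finally have "real t * ln p \<le> (real p * ?s + (real p - 1)) * ln p"
      using lnp by (intro mult_right_mono) auto
    also have "\<dots> = real ?s * ln p + (real p - 1) * (?s * ln p + ln p)"
      by (simp add: algebra_simps)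
    also have "\<dots> \<le> (real p - 1) * (?v ?s * ln p + ln p + ln ?s) + (real p - 1) * (?s * ln p + ln p)"
      using IH by simp
    also have "\<dots> = (real p - 1) * ((?s + ?v ?s) * ln p + ln p + (ln p + ln ?s))"
      by (simp add: algebra_simps)
    also have "ln p + ln ?s = ln (real (p * ?s))"
      using False p2 by (simp add: ln_mult_pos)
    also have "(real p - 1) * ((?s + ?v ?s) * ln p + ln p + ln (real (p * ?s))) \<le>
        (real p - 1) * ((?s + ?v ?s) * ln p + ln p + ln (real t))"
    proof (intro mult_left_mono add_left_mono ln_mono of_nat_mono)
      show "p * ?s \<le> t" by simp
      show "0 < real (p * ?s)" using False p2 by simp
    qed (use p2 in auto)
    also have "real ?s + ?v ?s = ?v t"
      using multiplicity_fact_div[OF p, of t] by simp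
    finally show ?thesis by simp
  qed
qed

lemma ln_fact_eq: "ln (fact t) = (\<Sum>p | prime p \<and> p \<le> t. multiplicity p (fact t :: nat) * ln (real p))"
proof -
  have pf: "prime_factors (fact t :: nat) = {p. prime p \<and> p \<le> t}"
    by (auto simp: prime_factors_dvd prime_dvd_fact_iff)
  have "(fact t :: nat) = (\<Prod>p | prime p \<and> p \<le> t. p ^ multiplicity p (fact t :: nat))"
    using prod_prime_factors[of "fact t :: nat"] pf by simp
  then have "(fact t :: real) = (\<Prod>p | prime p \<and> p \<le> t. real p ^ multiplicity p (fact t :: nat))"
    by (metis (mono_tags, lifting) of_nat_fact of_nat_power of_nat_prod prod.cong)
  then have "ln (fact t :: real) = (\<Sum>p | prime p \<and> p \<le> t. ln (real p ^ multiplicity p (fact t :: nat)))"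
    by (simp only:) (rule ln_prod, auto simp: prime_gt_0_nat)
  also have "\<dots> = (\<Sum>p | prime p \<and> p \<le> t. multiplicity p (fact t :: nat) * ln (real p))"
    by (rule sum.cong) (auto simp: ln_realpow prime_gt_0_nat)
  finally show ?thesis .
qed

text \<open>
  The value \<open>ln (t + 1)\<close> instead of \<open>ln t\<close> is essential: a sum over primes is constant between
  integers, so Abel summation must compare it with the logarithm at the right end of each step.
\<close>

lemma ln_fact_lower: "real t * (ln (real t + 1) - 1) \<le> ln (fact t)"
proof (induction t)
  case (Suc t)
  have "ln (1 + 1 / (real t + 1)) \<le> 1 / (real t + 1)" by (rule ln_add_one_self_le_self) simp
  moreover have "1 + 1 / (real t + 1) = (real t + 2) / (real t + 1)" by (simp add: field_simps)
  ultimately have "(real t + 1) * (ln (real t + 2) - ln (real t + 1)) \<le> 1"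
    by (simp add: ln_div field_simps)
  moreover have "ln (fact (Suc t)) = ln (real t + 1) + ln (fact t)"
    by (simp add: ln_mult_pos)
  ultimately show ?case using Suc by (simp add: algebra_simps)
qed simp

lemma ln_fact_upper:
  assumes "t > 0"
  shows "ln (fact t) \<le> (real t + 1) * ln t - t + 1"
  using assms
proof (induction t rule: nat_induct_non_zero)
  case (Suc t)
  have t: "real t > 0" using Suc by simp
  have "real t * (ln (real t + 1) - ln (real t)) \<ge> 1 - (ln (real t + 1) - ln (real t))"
  proof -
    have "ln (1 - 1 / (real t + 1)) \<le> - 1 / (real t + 1)"
      using ln_le_minus_one[of "1 - 1 / (real t + 1)"] t by (simp add: field_simps)
    moreover have "1 - 1 / (real t + 1) = real t / (real t + 1)" using t by (simp add: field_simps)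
    ultimately have "ln (real t) - ln (real t + 1) \<le> - 1 / (real t + 1)"
      using t by (simp add: ln_div)
    then show ?thesis using t by (simp add: field_simps)
  qed
  moreover have "ln (fact (Suc t)) = ln (real t + 1) + ln (fact t)"
    by (simp add: ln_mult_pos)
  ultimately show ?case using Suc by (simp add: algebra_simps)
qed simp

text \<open>
  The weight \<open>ln p / (p - 1)\<close> equals \<open>ln p * (\<Sum>k\<ge>1. 1 / p ^ k)\<close> and so accounts for all powers of \<open>p\<close> in
  \<open>t!\<close>; with it the lower bound loses nothing to higher prime powers.
\<close>

definition mertens_sum :: "nat \<Rightarrow> real" where
  "mertens_sum t = (\<Sum>p | prime p \<and> p \<le> t. ln (real p) / (real p - 1))"

lemma mertens_sum_lower: "ln (real t + 1) - 1 \<le> mertens_sum t"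
proof (cases "t = 0")
  case False
  have "real t * (ln (real t + 1) - 1) \<le> ln (fact t)" by (rule ln_fact_lower)
  also have "\<dots> = (\<Sum>p | prime p \<and> p \<le> t. multiplicity p (fact t :: nat) * ln (real p))"
    by (rule ln_fact_eq)
  also have "\<dots> \<le> (\<Sum>p | prime p \<and> p \<le> t. real t * (ln (real p) / (real p - 1)))"
  proof (rule sum_mono)
    fix p assume "p \<in> {p. prime p \<and> p \<le> t}"
    then have p: "prime p" "p \<ge> 2" using prime_ge_2_nat by auto
    have "real ((p - 1) * multiplicity p (fact t :: nat)) \<le> real t"
      using multiplicity_fact_upper[OF p(1)] by (rule of_nat_mono)
    then have "multiplicity p (fact t :: nat) \<le> real t / (real p - 1)"
      using p(2) by (simp add: pos_le_divide_eq of_nat_diff mult.commute)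
    then have "multiplicity p (fact t :: nat) * ln (real p) \<le> real t / (real p - 1) * ln (real p)"
      using p(2) by (intro mult_right_mono) auto
    then show "multiplicity p (fact t :: nat) * ln (real p) \<le> real t * (ln (real p) / (real p - 1))"
      by simp
  qed
  also have "\<dots> = real t * mertens_sum t" by (simp add: mertens_sum_def sum_distrib_left)
  finally show ?thesis using False by simp
qed (simp add: mertens_sum_def)

text \<open>
  The function \<open>(ln x + 1) / (2 * x)\<close> decreases by at least the summand between consecutive odd
  numbers from \<open>9\<close> on. The added term is its value at the largest odd number up to \<open>m\<close>, which makes
  the telescoping sum provable by induction.
\<close>

lemma sum_ln_over_odd_le:
  assumes "m \<ge> 10"
  shows "(\<Sum>k | odd k \<and> 11 \<le> k \<and> k \<le> m. ln (real k) / (real k * (real k - 1))) +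
     (ln (real (if odd m then m else m - 1)) + 1) / (2 * real (if odd m then m else m - 1))
     \<le> (ln 9 + 1) / 18"
  using assms
proof (induction m rule: dec_induct)
  case base
  have none: "{k::nat. odd k \<and> 11 \<le> k \<and> k \<le> 10} = {}" by auto
  show ?case unfolding none by simp
next
  case (step m)
  let ?h = "\<lambda>k. ln (real k) / (real k * (real k - 1))"
  show ?case
  proof (cases "odd m")
    case True
    then have "{k. odd k \<and> 11 \<le> k \<and> k \<le> Suc m} = {k. odd k \<and> 11 \<le> k \<and> k \<le> m}"
      by (auto simp: le_Suc_eq)
    then show ?thesis using step.IH True by simp
  next
    case False
    define x where "x = real (Suc m)"
    have x: "x \<ge> 11" using step.hyps False by (simp add: x_def)
    have m1: "real (m - 1) = x - 2" using step.hyps by (simp add: x_def of_nat_diff)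
    have "{k. odd k \<and> 11 \<le> k \<and> k \<le> Suc m} = insert (Suc m) {k. odd k \<and> 11 \<le> k \<and> k \<le> m}"
      using False step.hyps by (auto simp: le_Suc_eq)
    then have sum: "(\<Sum>k | odd k \<and> 11 \<le> k \<and> k \<le> Suc m. ?h k) =
        ?h (Suc m) + (\<Sum>k | odd k \<and> 11 \<le> k \<and> k \<le> m. ?h k)" by simp
    have "ln x / (x * (x - 1)) + (ln x + 1) / (2 * x) \<le> (ln (x - 2) + 1) / (2 * (x - 2))"
    proof -
      have ln11: "ln x \<ge> 9 / 4"
      proof -
        have "(1 / 11 :: real) \<le> (1 - (9 / 4) / real 32) ^ 32" by (simp add: field_simps)
        also have "\<dots> \<le> exp (- (9 / 4))" by (rule exp_ge_one_minus_x_over_n_power_n) auto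
        finally have "exp (9 / 4 :: real) \<le> 11" by (simp add: exp_minus field_simps)
        then show ?thesis using x by (subst ln_ge_iff) auto
      qed
      have "ln (1 - 2 / x) = - ln (1 + 2 / (x - 2))"
      proof -
        have "1 - 2 / x = inverse (1 + 2 / (x - 2))" using x by (simp add: field_simps)
        then show ?thesis by (simp only: ln_inverse)
      qed
      moreover have "ln (1 + 2 / (x - 2)) \<le> 2 / (x - 2)"
        using x by (intro ln_add_one_self_le_self) auto
      moreover have "ln (x - 2) = ln x + ln (1 - 2 / x)"
        using x by (subst ln_mult_pos[symmetric]) (auto simp: field_simps)
      ultimately have "ln (x - 2) \<ge> ln x - 2 / (x - 2)" by linarith
      then have "(ln (x - 2) + 1) / (2 * (x - 2)) \<ge> (ln x - 2 / (x - 2) + 1) / (2 * (x - 2))"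
        using x by (intro divide_right_mono) auto
      moreover have "(ln x - 2 / (x - 2) + 1) / (2 * (x - 2)) - (ln x + 1) / (2 * x) - ln x / (x * (x - 1))
          = (ln x * (x - 2) - 2 * (x - 1)) / (x * (x - 1) * (x - 2)^2)"
        using x by (simp add: divide_simps) (simp add: algebra_simps power2_eq_square)
      moreover have "ln x * (x - 2) \<ge> 9 / 4 * (x - 2)"
        using x ln11 by (intro mult_right_mono) auto
      then have "(ln x * (x - 2) - 2 * (x - 1)) / (x * (x - 1) * (x - 2)^2) \<ge> 0"
        using x by (intro divide_nonneg_pos) auto
      ultimately show ?thesis by linarith
    qed
    moreover note step.IH[unfolded if_not_P[OF False] m1]
    moreover have "odd (Suc m)" using False by simp
    ultimately show ?thesis unfolding sum if_P[OF \<open>odd (Suc m)\<close>] x_def[symmetric]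
      by linarith
  qed
qed

lemma sum_ln_over_primes_le:
  "(\<Sum>p | prime p \<and> 11 \<le> p \<and> p \<le> a. ln (real p) / (real p * (real p - 1))) \<le> (ln 9 + 1) / 18"
proof (cases "a \<ge> 10")
  case True
  have "(\<Sum>p | prime p \<and> 11 \<le> p \<and> p \<le> a. ln (real p) / (real p * (real p - 1)))
     \<le> (\<Sum>p | odd p \<and> 11 \<le> p \<and> p \<le> a. ln (real p) / (real p * (real p - 1)))"
    using prime_odd_nat by (intro sum_mono2) (auto intro!: divide_nonneg_nonneg)
  moreover have "0 \<le> (ln (real (if odd a then a else a - 1)) + 1) / (2 * real (if odd a then a else a - 1))"
    using True by (intro divide_nonneg_nonneg add_nonneg_nonneg) auto
  ultimately show ?thesis using sum_ln_over_odd_le[OF True] by linarith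
next
  case False
  then have none: "{p. prime p \<and> 11 \<le> p \<and> p \<le> a} = {}" by auto
  show ?thesis unfolding none by simp
qed

lemma primes_le_10: "{p::nat. prime p \<and> p \<le> 10} = {2, 3, 5, 7}"
proof -
  have "p \<in> {0,1,2,3,4,5,6,7,8,9,10}" if "p \<le> 10" for p :: nat using that by auto presburger
  then have "{p::nat. prime p \<and> p \<le> 10} = {p\<in>{0,1,2,3,4,5,6,7,8,9,10}. prime p}" by auto
  also have "\<dots> = {2, 3, 5, 7}" by auto
  finally show ?thesis .
qed

text \<open>
  The primes \<open>2, 3, 5, 7\<close> enter with their full exponent in \<open>a!\<close>, at a cost of about \<open>ln a\<close> each. For
  larger primes only the first power is used; the cost is Chebyshev's \<open>a * ln 4\<close> from rounding
  \<open>a / p\<close> down, and \<open>\<Sum> ln p / (p * (p - 1))\<close> over \<open>p \<ge> 11\<close> from the neglected powers.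
\<close>

lemma mertens_sum_upper:
  assumes a: "a \<ge> 10"
  shows "mertens_sum a \<le> ln a - 1 + ln 4 + (ln 9 + 1) / 18 + (5 * ln a + 1) / a"
proof -
  let ?P = "{p::nat. prime p \<and> p \<le> a}" and ?S = "{p::nat. prime p \<and> p \<le> 10}"
  let ?L = "{p::nat. prime p \<and> 11 \<le> p \<and> p \<le> a}"
  let ?v = "\<lambda>p. multiplicity p (fact a :: nat) * ln (real p)"
  have P: "?P = ?S \<union> ?L" "?S \<inter> ?L = {}" using a by auto
  have split: "(\<Sum>p\<in>?P. f p) = (\<Sum>p\<in>?S. f p) + (\<Sum>p\<in>?L. f p)" for f :: "nat \<Rightarrow> real"
    unfolding P(1) by (rule sum.union_disjoint) auto
  have ln_a: "ln (real a) \<ge> 0" using a by simp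
  have small: "a * (ln (real p) / (real p - 1)) \<le> ?v p + ln p + ln a" if "p \<in> ?S" for p
  proof -
    have p: "prime p" "real p - 1 > 0" using that prime_gt_1_nat[of p] by auto
    have "real a * ln p \<le> (real p - 1) * (?v p + ln p + ln a)"
      using multiplicity_fact_lower[OF p(1)] a by simp
    then show ?thesis using p(2) by (simp add: pos_divide_le_eq mult.commute)
  qed
  have large: "a * (ln (real p) / (real p - 1)) \<le> ?v p + ln p + a * (ln (real p) / (real p * (real p - 1)))"
    if "p \<in> ?L" for p
  proof -
    have p: "prime p" "real p \<ge> 11" using that by auto
    have "real a / real p \<le> real (a div p) + 1"
      using floor_divide_of_nat_eq[of a p, where 'a = real] by linarith
    also have "a div p \<le> multiplicity p (fact a :: nat)"
      using multiplicity_fact_div[OF p(1), of a] by simp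
    finally have "real a / real p * ln p \<le> (real (multiplicity p (fact a :: nat)) + 1) * ln p"
      using p by (intro mult_right_mono) auto
    then have "real a * (ln p / p) \<le> ?v p + ln p" by (simp add: algebra_simps)
    moreover have "ln (real p) / (real p - 1) = ln p / p + ln p / (real p * (real p - 1))"
      using p(2) by (simp add: field_simps)
    ultimately show ?thesis by (simp add: algebra_simps)
  qed
  have "a * mertens_sum a = (\<Sum>p\<in>?S. a * (ln (real p) / (real p - 1))) + (\<Sum>p\<in>?L. a * (ln (real p) / (real p - 1)))"
    unfolding mertens_sum_def split[symmetric] by (rule sum_distrib_left)
  also have "\<dots> \<le> (\<Sum>p\<in>?S. ?v p + ln p + ln a) +
      (\<Sum>p\<in>?L. ?v p + ln p + a * (ln (real p) / (real p * (real p - 1))))"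
    by (intro add_mono sum_mono small large)
  also have "\<dots> = (\<Sum>p\<in>?P. ?v p) + (\<Sum>p\<in>?P. ln (real p)) + real (card ?S) * ln a
      + a * (\<Sum>p\<in>?L. ln (real p) / (real p * (real p - 1)))"
    unfolding split by (simp add: sum.distrib sum_distrib_left)
  also have "(\<Sum>p\<in>?P. ?v p) = ln (fact a)" by (rule ln_fact_eq[symmetric])
  also have "card ?S = 4" unfolding primes_le_10 by simp
  also have "ln (fact a) \<le> (real a + 1) * ln a - a + 1" using a by (intro ln_fact_upper) auto
  also have "(\<Sum>p\<in>?P. ln (real p)) \<le> a * ln 4" by (rule sum_ln_primes_le)
  also have "a * (\<Sum>p\<in>?L. ln (real p) / (real p * (real p - 1))) \<le> a * ((ln 9 + 1) / 18)"
    by (intro mult_left_mono sum_ln_over_primes_le) auto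
  finally have "a * mertens_sum a \<le>
      a * (ln a - 1 + ln 4 + (ln 9 + 1) / 18) + (5 * ln a + 1)"
    by (simp add: algebra_simps)
  also have "5 * ln a + 1 = a * ((5 * ln a + 1) / a)" using a by simp
  finally have "a * mertens_sum a \<le>
      a * (ln a - 1 + ln 4 + (ln 9 + 1) / 18 + (5 * ln a + 1) / a)"
    by (simp only: distrib_left)
  then show ?thesis using a by (simp add: mult_le_cancel_left)
qed

text \<open>
  Every logarithm of a prime is replaced by a rational multiple of \<open>ln 2\<close>. This is crude but more than
  enough, and it is convenient because the bound is used against \<open>ln 64 = 6 * ln 2\<close>.
\<close>

lemma mertens_sum_63: "mertens_sum 63 \<le> 287 / 50 * ln 2"
proof -
  let ?f = "\<lambda>p::nat. ln (real p) / (real p - 1)"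
  let ?L = "[2,3,5,7,11,13,17,19,23,29,31,37,41,43,47,53,59,61] :: nat list"
  have "{p::nat. prime p \<and> p \<le> 63} = {p\<in>set [2..<64]. prime p}"
    by (auto simp del: upt_rec_numeral dest: prime_ge_2_nat)
  also have "\<dots> = set (filter prime [2..<64])" by (rule set_filter[symmetric])
  also have "filter prime [2..<64] = ?L" by simp
  finally have P: "{p::nat. prime p \<and> p \<le> 63} = set ?L" .
  have b: "?f p \<le> (k / c) * ln 2 / (real p - 1)" if "p > 1" "p ^ c \<le> 2 ^ k" "c > 0" for p k c :: nat
  proof -
    have "real c * ln (real p) = ln (real (p ^ c))" using that by (simp add: ln_realpow)
    also have "\<dots> \<le> ln (real (2 ^ k))"
      using that by (intro ln_mono of_nat_mono) auto
    also have "\<dots> = k * ln 2" by (simp add: ln_realpow)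
    finally have "ln (real p) \<le> (k / c) * ln 2" using that by (simp add: field_simps)
    then show ?thesis using that by (intro divide_right_mono) auto
  qed
  \<comment> \<open>an entry \<open>(p, k, c)\<close> records \<open>p ^ c \<le> 2 ^ k\<close>, that is \<open>ln p \<le> k / c * ln 2\<close>\<close>
  define T :: "(nat \<times> nat \<times> nat) list" where
    "T = [(2, 1, 1), (3, 8, 5), (5, 7, 3), (7, 3, 1), (11, 4, 1), (13, 4, 1), (17, 5, 1), (19, 5, 1),
      (23, 5, 1), (29, 5, 1), (31, 5, 1), (37, 6, 1), (41, 6, 1), (43, 6, 1), (47, 6, 1), (53, 6, 1),
      (59, 6, 1), (61, 6, 1)]"
  have T: "\<forall>(p, k, c)\<in>set T. p > 1 \<and> p ^ c \<le> 2 ^ k \<and> c > 0" by (simp add: T_def)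
  have "mertens_sum 63 = (\<Sum>p\<leftarrow>?L. ?f p)"
    unfolding mertens_sum_def P by (subst sum.distinct_set_conv_list) simp_all
  also have "\<dots> = (\<Sum>(p, k, c)\<leftarrow>T. ?f p)" by (simp add: T_def)
  also have "\<dots> \<le> (\<Sum>(p, k, c)\<leftarrow>T. (real k / real c) * ln 2 / (real p - 1))"
    using T b by (intro sum_list_mono) (auto split: prod.splits)
  also have "\<dots> = (\<Sum>(p, k, c)\<leftarrow>T. (real k / real c) / (real p - 1)) * ln 2"
    by (simp add: sum_list_mult_const[symmetric] case_prod_unfold)
  also have "\<dots> \<le> 287 / 50 * ln 2"
    by (intro mult_right_mono) (simp_all add: T_def)
  finally show ?thesis .
qed

section \<open>Reciprocals of primes in an interval\<close>

text \<open>
  Abel summation. The induction carries the surplus of the partial sum over its lower bound as an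
  extra term with weight \<open>1 / ln (b + 1)\<close>; each step then gains \<open>(ln (b + 2) - ln (b + 1)) / ln (b + 1)\<close>,
  which dominates the increment of \<open>ln (ln (b + 1))\<close>.
\<close>

lemma abel_summation_lower:
  fixes q b :: nat and f :: "nat \<Rightarrow> real" and w :: real
  assumes q: "q \<ge> 2" and b: "q - 1 \<le> b"
    and F: "\<And>m. q - 1 \<le> m \<Longrightarrow> ln (real m + 1) - ln q - w \<le> (\<Sum>k=q..m. f k)"
  shows "ln (ln (real b + 1)) - ln (ln q) - w / ln q \<le> (\<Sum>k=q..b. f k / ln k)"
proof -
  let ?F = "\<lambda>m. \<Sum>k=q..m. f k" and ?D = "\<lambda>m::nat. ln (real m + 1) - ln q - w"
  have "ln (ln (real b + 1)) - ln (ln q) - w / ln q \<le>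
      (\<Sum>k=q..b. f k / ln k) - (?F b - ?D b) / ln (real b + 1)"
    using b
  proof (induction b rule: dec_induct)
    case base
    have "{q..q - 1} = {}" "real (q - 1) + 1 = real q" using q by auto
    then show ?case by simp
  next
    case (step b)
    define x where "x = ln (real b + 1)"
    define y where "y = ln (real b + 2)"
    have xy: "0 < x" "x \<le> y" using step.hyps q by (auto simp: x_def y_def)
    have "(?F (Suc b) - ?D (Suc b)) / y \<le> (?F (Suc b) - ?D (Suc b)) / x"
      using xy F[of "Suc b"] step.hyps by (intro divide_left_mono) (auto simp: add.commute)
    moreover have "?F (Suc b) = ?F b + f (Suc b)" using step.hyps q by simp
    moreover have "ln y - ln x \<le> (y - x) / x"
    proof -
      have "ln y - ln x = ln (y / x)" using xy by (simp add: ln_div)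
      also have "\<dots> \<le> y / x - 1" using xy by (intro ln_le_minus_one) auto
      finally show ?thesis using xy by (simp add: diff_divide_distrib)
    qed
    moreover have "?D (Suc b) = ?D b + (y - x)" by (simp add: x_def y_def add.commute)
    moreover have "(\<Sum>k=q..Suc b. f k / ln k) = (\<Sum>k=q..b. f k / ln k) + f (Suc b) / x"
      using step.hyps q by (simp add: x_def add.commute)
    moreover have "real (Suc b) + 1 = real b + 2" by simp
    ultimately show ?case
      using step.IH unfolding x_def[symmetric] y_def[symmetric]
      by (simp add: add_divide_distrib diff_divide_distrib y_def[symmetric] x_def[symmetric])
  qed
  moreover have "(?F b - ?D b) / ln (real b + 1) \<ge> 0"
    using F[OF b] b q by (intro divide_nonneg_nonneg) auto
  ultimately show ?thesis by linarith
qed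

lemma sum_reciprocals_primes_ge:
  assumes q: "q \<ge> 2" and b: "q - 1 \<le> b" and w: "1 + mertens_sum (q - 1) - ln q \<le> w"
  shows "ln (ln (real b + 1)) - ln (ln q) - w / ln q \<le> (\<Sum>p | prime p \<and> q \<le> p \<and> p \<le> b. 1 / (real p - 1))"
proof -
  let ?f = "\<lambda>k::nat. if prime k then ln (real k) / (real k - 1) else 0"
  have "ln (ln (real b + 1)) - ln (ln q) - w / ln q \<le> (\<Sum>k=q..b. ?f k / ln k)"
  proof (rule abel_summation_lower[OF q b])
    fix m assume m: "q - 1 \<le> m"
    have "mertens_sum m = mertens_sum (q - 1) + (\<Sum>k=q..m. ?f k)"
    proof -
      have "{p. prime p \<and> p \<le> m} = {p. prime p \<and> p \<le> q - 1} \<union> {p\<in>{q..m}. prime p}"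
        using m q by auto
      then have "mertens_sum m = mertens_sum (q - 1) + (\<Sum>p\<in>{p\<in>{q..m}. prime p}. ln (real p) / (real p - 1))"
        unfolding mertens_sum_def using q by (simp only:) (rule sum.union_disjoint, auto)
      then show ?thesis by (simp only: sum.inter_filter finite_atLeastAtMost)
    qed
    then show "ln (real m + 1) - ln q - w \<le> (\<Sum>k=q..m. ?f k)"
      using mertens_sum_lower[of m] w by linarith
  qed
  also have "\<dots> = (\<Sum>k=q..b. if prime k then 1 / (real k - 1) else 0)"
    using q by (intro sum.cong) auto
  also have "\<dots> = (\<Sum>p\<in>{p\<in>{q..b}. prime p}. 1 / (real p - 1))"
    by (rule sum.inter_filter[symmetric]) simp
  also have "{p\<in>{q..b}. prime p} = {p. prime p \<and> q \<le> p \<and> p \<le> b}" by auto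
  finally show ?thesis .
qed

text \<open>
  The summand is at most \<open>1 / (k * (k - 2)) = 1 / (2 * (k - 2)) - 1 / (2 * k)\<close>, which telescopes over odd \<open>k\<close>. The
  added term is the part of the telescoping sum still available after the largest odd number up to \<open>b\<close>.
\<close>

lemma sum_inverse_consecutive_odd_le:
  assumes q: "q \<ge> 4" and b: "q - 1 \<le> b"
  shows "(\<Sum>k | odd k \<and> q \<le> k \<and> k \<le> b. 1 / (real k * (real k - 1)))
     + 1 / (2 * real (if odd b then b else b - 1)) \<le> 1 / (2 * (real q - 2))"
  using b
proof (induction b rule: dec_induct)
  case base
  have none: "{k. odd k \<and> q \<le> k \<and> k \<le> q - 1} = {}" using q by auto
  have "1 / (2 * real (if odd (q - 1) then q - 1 else q - 1 - 1)) \<le> 1 / (2 * (real q - 2))"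
    using q by (intro divide_left_mono) auto
  then show ?case unfolding none by simp
next
  case (step m)
  let ?h = "\<lambda>k. 1 / (real k * (real k - 1))"
  show ?case
  proof (cases "odd m")
    case True
    then have "{k. odd k \<and> q \<le> k \<and> k \<le> Suc m} = {k. odd k \<and> q \<le> k \<and> k \<le> m}"
      by (auto simp: le_Suc_eq)
    then show ?thesis using step.IH True by simp
  next
    case False
    define x where "x = real (Suc m)"
    have x: "x \<ge> 4" using step.hyps q by (simp add: x_def)
    have m1: "real (m - 1) = x - 2" using step.hyps q by (simp add: x_def of_nat_diff)
    have "{k. odd k \<and> q \<le> k \<and> k \<le> Suc m} = insert (Suc m) {k. odd k \<and> q \<le> k \<and> k \<le> m}"
      using False step.hyps q by (auto simp: le_Suc_eq)
    then have sum: "(\<Sum>k | odd k \<and> q \<le> k \<and> k \<le> Suc m. ?h k) =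
        ?h (Suc m) + (\<Sum>k | odd k \<and> q \<le> k \<and> k \<le> m. ?h k)" by simp
    have "1 / (x * (x - 1)) \<le> 1 / (x * (x - 2))"
      using x by (intro divide_left_mono mult_left_mono mult_pos_pos) auto
    also have "\<dots> = 1 / (2 * (x - 2)) - 1 / (2 * x)" using x by (simp add: field_simps)
    finally have "1 / (x * (x - 1)) + 1 / (2 * x) \<le> 1 / (2 * (x - 2))" by simp
    moreover note step.IH[unfolded if_not_P[OF False] m1]
    moreover have "odd (Suc m)" using False by simp
    ultimately show ?thesis unfolding sum if_P[OF \<open>odd (Suc m)\<close>] x_def[symmetric]
      by linarith
  qed
qed

lemma sum_inverse_consecutive_primes_le:
  assumes q: "q \<ge> 4" and b: "q - 1 \<le> b"
  shows "(\<Sum>p | prime p \<and> q \<le> p \<and> p \<le> b. 1 / (real p * (real p - 1))) \<le> 1 / (2 * (real q - 2))"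
proof -
  have "(\<Sum>p | prime p \<and> q \<le> p \<and> p \<le> b. 1 / (real p * (real p - 1)))
     \<le> (\<Sum>p | odd p \<and> q \<le> p \<and> p \<le> b. 1 / (real p * (real p - 1)))"
    using prime_odd_nat q by (intro sum_mono2) (auto intro!: divide_nonneg_nonneg)
  moreover have "0 \<le> 1 / (2 * real (if odd b then b else b - 1))" by simp
  ultimately show ?thesis using sum_inverse_consecutive_odd_le[OF q b] by linarith
qed

section \<open>The choice of the smallest prime\<close>

lemma ln_2_bounds: "307 / 443 < ln (2::real)" "ln (2::real) < 4615 / 6658"
proof -
  have "ln (2::real) \<in> {307 / 443<..<4615 / 6658}"
    using ln_approx_bounds[of 2 3] by (simp add: eval_nat_numeral)
  then show "307 / 443 < ln (2::real)" "ln (2::real) < 4615 / 6658" by simp_all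
qed

text \<open>
  Rational lower bounds of logarithms, obtained by comparing a power of \<open>x\<close> with a power of \<open>2\<close>.
\<close>

lemma ln_ge_of_power:
  fixes x :: real and c k :: nat
  assumes "2 ^ k \<le> x ^ c" "c > 0" "x > 0"
  shows "(k / c) * ln 2 \<le> ln x"
proof -
  have "k * ln 2 = ln (2 ^ k :: real)" by (simp add: ln_realpow)
  also have "\<dots> \<le> ln (x ^ c)" using assms by (intro ln_mono) auto
  also have "\<dots> = c * ln x" using assms by (simp add: ln_realpow)
  finally show ?thesis using assms by (simp add: field_simps)
qed

text \<open>
  This combines both contributions for an arbitrary smallest prime \<open>q\<close>. The number \<open>w\<close> bounds the
  error of Mertens' sum at \<open>q\<close>; it enters only through \<open>w / ln q\<close>. After multiplication by
  \<open>ln (n - 3)\<close> the right-hand side depends only on \<open>q\<close>, \<open>w\<close> and \<open>ln n\<close>.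
\<close>

lemma prime_reciprocals_tail_le:
  fixes n q :: nat
  assumes q: "4 \<le> q" "q + 2 \<le> n" and w: "1 + mertens_sum (q - 1) - ln q \<le> w"
  defines "C \<equiv> {p. prime p \<and> q \<le> p \<and> p \<le> n - 3}"
  shows "(exp (13 / 22 - (\<Sum>p\<in>C. 1 / real p)) + (\<Sum>p\<in>C. harm (n div p) / (real p)\<^sup>2)) * ln (real n - 3)
    \<le> ln q * exp (13 / 22 + (w / ln q + 1 / (2 * (real q - 2)))) + (ln n)\<^sup>2 / (2 * (real q - 2))"
proof -
  define d where "d = 1 / (2 * (real q - 2))"
  define s where "s = (\<Sum>p\<in>C. 1 / (real p * (real p - 1)))"
  have b: "q - 1 \<le> n - 3" using q by simp
  have n6: "real n \<ge> 6" using q by simp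
  have n3: "real (n - 3) + 1 = real n - 2" using q by (simp add: of_nat_diff)
  have ln_pos: "0 < ln (real n - 3)" "ln (real n - 3) \<le> ln (real n - 2)" "ln (real n - 3) \<le> ln n"
    using n6 by auto
  have ln_q: "ln q > 0" using q by simp
  have s: "s \<le> d" unfolding s_def d_def C_def by (rule sum_inverse_consecutive_primes_le[OF q(1) b])
  have C: "p \<ge> 4" "p \<le> n" if "p \<in> C" for p using that q by (auto simp: C_def)
  have "(\<Sum>p\<in>C. 1 / real p) = (\<Sum>p\<in>C. 1 / (real p - 1) - 1 / (real p * (real p - 1)))"
  proof (rule sum.cong)
    fix p assume "p \<in> C"
    then have "real p \<noteq> 0" "real p - 1 \<noteq> 0" using C(1)[of p] by auto
    then show "1 / real p = 1 / (real p - 1) - 1 / (real p * (real p - 1))"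
      by (simp add: divide_simps)
  qed simp
  also have "\<dots> = (\<Sum>p\<in>C. 1 / (real p - 1)) - s" by (simp add: sum_subtractf s_def)
  finally have S: "(\<Sum>p\<in>C. 1 / real p) \<ge> ln (ln (real n - 2)) - ln (ln q) - w / ln q - d"
    using sum_reciprocals_primes_ge[OF _ b w] s q unfolding n3 C_def by simp
  have "exp (13 / 22 - (\<Sum>p\<in>C. 1 / real p)) \<le>
      exp ((13 / 22 + (w / ln q + d)) + ln (ln q) - ln (ln (real n - 2)))"
    using S by simp
  also have "\<dots> = exp (13 / 22 + (w / ln q + d)) * ln q / ln (real n - 2)"
    using ln_q ln_pos by (simp only: exp_add exp_diff) simp
  finally have "exp (13 / 22 - (\<Sum>p\<in>C. 1 / real p)) * ln (real n - 3) \<le>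
      exp (13 / 22 + (w / ln q + d)) * ln q / ln (real n - 2) * ln (real n - 3)"
    using ln_pos by (intro mult_right_mono) auto
  also have "\<dots> = exp (13 / 22 + (w / ln q + d)) * ln q * (ln (real n - 3) / ln (real n - 2))" by simp
  also have "\<dots> \<le> exp (13 / 22 + (w / ln q + d)) * ln q * 1"
    using ln_pos ln_q by (intro mult_left_mono) auto
  finally have first: "exp (13 / 22 - (\<Sum>p\<in>C. 1 / real p)) * ln (real n - 3) \<le>
      ln q * exp (13 / 22 + (w / ln q + d))" by (simp add: mult.commute)
  have "(\<Sum>p\<in>C. harm (n div p) / (real p)\<^sup>2) \<le> (\<Sum>p\<in>C. ln n * (1 / (real p * (real p - 1))))"
  proof (rule sum_mono)
    fix p assume p: "p \<in> C"
    then have rp: "real p \<ge> 4" using C(1)[of p] by simp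
    have pos: "n div p > 0" using C[OF p] rp by (simp add: div_greater_zero_iff)
    then have "harm (n div p) \<le> 1 + ln (real (n div p))"
      using euler_mascheroni_sequence_decreasing[of 1 "n div p"] by (simp add: harm_def)
    also have "ln (real (n div p)) \<le> ln (real n / real p)"
      using pos of_nat_div_le_of_nat[of n p, where 'a = real] by (intro ln_mono) auto
    also have "\<dots> = ln n - ln p" using n6 rp by (simp add: ln_div)
    also have "ln (real p) \<ge> 1"
    proof -
      have "2 * ln 2 = ln (4::real)" using ln_realpow[of "2::real" 2] by simp
      also have "\<dots> \<le> ln p" using rp by simp
      finally show ?thesis using ln2_ge_two_thirds by linarith
    qed
    finally have "harm (n div p) \<le> ln n" by simp
    then have "harm (n div p) / (real p)\<^sup>2 \<le> ln n / (real p)\<^sup>2" by (intro divide_right_mono) auto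
    also have "\<dots> \<le> ln n / (real p * (real p - 1))"
      using rp n6 by (intro divide_left_mono) (auto simp: power2_eq_square)
    finally show "harm (n div p) / (real p)\<^sup>2 \<le> ln n * (1 / (real p * (real p - 1)))" by simp
  qed
  also have "\<dots> = ln n * s" by (simp add: s_def sum_distrib_left)
  also have "\<dots> \<le> ln n * d" using s n6 by (intro mult_left_mono) auto
  finally have "(\<Sum>p\<in>C. harm (n div p) / (real p)\<^sup>2) * ln (real n - 3) \<le> ln n * d * ln n"
  proof (rule mult_mono)
    show "0 \<le> ln n * d" using n6 q by (simp add: d_def)
  qed (use ln_pos in auto)
  then have second: "(\<Sum>p\<in>C. harm (n div p) / (real p)\<^sup>2) * ln (real n - 3) \<le> (ln n)\<^sup>2 / (2 * (real q - 2))"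
    by (simp add: d_def power2_eq_square)
  show ?thesis
    using first second unfolding d_def by (simp only: distrib_right)
qed

text \<open>
  For small \<open>L = ln n\<close> the general upper bound for \<open>mertens_sum\<close> is too weak, so a constant threshold
  with an explicitly computed sum is used. Both sides are increasing in \<open>L\<close>, and comparing the left-hand side at the
  right end with the right-hand side at the left end works on each of five short intervals.
\<close>

lemma threshold_64_suffices:
  assumes L: "12 \<le> L" "L \<le> 26"
  shows "ln (real 64) * exp (13 / 22 + ((1 - (13 / 50) * ln 2) / ln (real 64) + 1 / (2 * (real 64 - 2))))
    + L\<^sup>2 / (2 * (real 64 - 2)) \<le> (933 / 200) * ln L"
proof -
  have ln64: "ln (real 64) = 6 * ln 2" using ln_realpow[of "2::real" 6] by simp
  have "(1 - (13 / 50) * ln (2::real)) / (6 * ln 2) \<le> (1973 / 10000)"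
    using ln_2_bounds by (subst pos_divide_le_eq) simp_all
  then have "13 / 22 + ((1 - (13 / 50) * ln 2) / ln (real 64) + 1 / (2 * (real 64 - 2)))
      \<le> 13 / 22 + (1973 / 10000 + 1 / (2 * (real 64 - 2)))"
    unfolding ln64 by (intro add_mono order_refl)
  also have "\<dots> \<le> (4 / 5)" by simp
  finally have "13 / 22 + ((1 - (13 / 50) * ln 2) / ln (real 64) + 1 / (2 * (real 64 - 2))) \<le> (4 / 5 :: real)" .
  then have "exp (13 / 22 + ((1 - (13 / 50) * ln 2) / ln (real 64) + 1 / (2 * (real 64 - 2)))) \<le> exp ((4 / 5)::real)"
    by simp
  also have "\<dots> \<le> (2237 / 1000)"
  proof -
    have "(1 / (2237 / 1000) :: real) \<le> (1 - (4 / 5) / real 64) ^ 64" by (simp add: field_simps)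
    also have "\<dots> \<le> exp (- (4 / 5))" by (rule exp_ge_one_minus_x_over_n_power_n) auto
    finally show ?thesis by (simp add: exp_minus field_simps)
  qed
  finally have "ln (real 64) * exp (13 / 22 + ((1 - (13 / 50) * ln 2) / ln (real 64) + 1 / (2 * (real 64 - 2))))
      \<le> (6 * (4615 / 6658)) * (2237 / 1000)"
    unfolding ln64 using ln_2_bounds by (intro mult_mono) auto
  also have "\<dots> \<le> (1163 / 125)" by simp
  finally have main: "ln (real 64) * exp (13 / 22 + ((1 - (13 / 50) * ln 2) / ln (real 64) + 1 / (2 * (real 64 - 2))))
      \<le> (1163 / 125)" .
  have *: "(1163 / 125) + L\<^sup>2 / 124 \<le> (933 / 200) * ln L"
    if "a \<le> L" "L \<le> b" "2 ^ k \<le> a ^ c" "c > 0" "a > 0"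
      "(1163 / 125) + b\<^sup>2 / 124 \<le> (933 / 200) * ((k / c) * (307 / 443))" for a b :: real and k c :: nat
  proof -
    have "L\<^sup>2 \<le> b\<^sup>2" using that L by (intro power_mono) auto
    moreover have "(k / c) * (307 / 443) \<le> ln L"
    proof -
      have "(k / c) * (307 / 443) \<le> (k / c) * ln 2"
        using ln_2_bounds by (intro mult_left_mono) auto
      also have "\<dots> \<le> ln a" using that by (intro ln_ge_of_power) auto
      also have "\<dots> \<le> ln L" using that by simp
      finally show ?thesis .
    qed
    ultimately show ?thesis using that(6) by simp
  qed
  consider "L \<le> 16" | "16 \<le> L" "L \<le> 20" | "20 \<le> L" "L \<le> 23" | "23 \<le> L" "L \<le> 25" | "25 \<le> L"
    by linarith
  then have "(1163 / 125) + L\<^sup>2 / 124 \<le> (933 / 200) * ln L"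
  proof cases
    case 1 then show ?thesis using *[of 12 16 25 7] L by simp
  next
    case 2 then show ?thesis using *[of 16 20 4 1] by simp
  next
    case 3 then show ?thesis using *[of 20 23 17 4] by simp
  next
    case 4 then show ?thesis using *[of 23 25 9 2] by simp
  next
    case 5 then show ?thesis using *[of 25 26 23 5] L by simp
  qed
  then show ?thesis using main by simp
qed

lemma exp_le_quadratic:
  fixes y :: real
  assumes "0 \<le> y" "y \<le> (7 / 20)"
  shows "exp y \<le> 1 + y + (3 / 5) * y\<^sup>2"
proof -
  obtain t where t: "\<bar>t\<bar> \<le> \<bar>y\<bar>" "exp y = (\<Sum>m<3. y ^ m / fact m) + exp t / fact 3 * y ^ 3"
    using Maclaurin_exp_le[of y 3] by blast
  have "exp t \<le> 1 + \<bar>t\<bar> + \<bar>t\<bar>\<^sup>2"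
  proof -
    have "exp t \<le> exp \<bar>t\<bar>" by simp
    also have "\<dots> \<le> 1 + \<bar>t\<bar> + \<bar>t\<bar>\<^sup>2" using t(1) assms by (intro exp_bound) auto
    finally show ?thesis .
  qed
  also have "\<dots> \<le> 1 + (7 / 20) + (7 / 20)\<^sup>2" using t assms by (intro add_mono power_mono) auto
  also have "\<dots> \<le> (3 / 2)" by (simp add: power2_eq_square)
  finally have bound: "exp t / 6 * y ^ 3 \<le> ((3 / 2) / 6) * ((7 / 20) * y\<^sup>2)"
  proof (intro mult_mono)
    show "y ^ 3 \<le> (7 / 20) * y\<^sup>2"
      using mult_right_mono[OF assms(2), of "y\<^sup>2"] by (simp add: power3_eq_cube power2_eq_square)
  qed (use assms in auto)
  have "(\<Sum>m<3. y ^ m / fact m) = 1 + y + y\<^sup>2 / 2"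
    by (simp add: eval_nat_numeral)
  moreover have "fact 3 = (6::real)" by (simp add: fact_numeral)
  ultimately have "exp y = 1 + y + y\<^sup>2 / 2 + exp t / 6 * y ^ 3" using t(2) by simp
  then show ?thesis using bound zero_le_power2[of y] by linarith
qed

text \<open>
  Write \<open>x = ln q\<close>. With an error term \<open>w\<close> of at most \<open>3383 / 2000 = 1.6915\<close> the first contribution is
  \<open>exp (13 / 22) * x * exp y\<close> where \<open>y \<approx> w / x\<close>, and expanding the exponential turns it into
  \<open>exp (13 / 22) * (x + w + O(1 / x))\<close>. As \<open>x \<le> 2 * ln L - ln 3\<close>, this is at most \<open>1.816 * (2 * ln L + 0.94)\<close>,
  while the second contribution is at most \<open>1.521\<close>.
\<close>

lemma threshold_third_of_square_suffices:
  assumes L: "L \<ge> 26"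
  defines "q \<equiv> nat \<lfloor>L\<^sup>2 / 3\<rfloor>"
  shows "1 + mertens_sum (q - 1) - ln q \<le> (3383 / 2000)"
    and "ln q * exp (13 / 22 + ((3383 / 2000) / ln q + 1 / (2 * (real q - 2)))) + L\<^sup>2 / (2 * (real q - 2))
      \<le> (933 / 200) * ln L"
    and "225 \<le> q" "real q \<le> L\<^sup>2 / 3"
proof -
  have L2: "L\<^sup>2 \<ge> 676" using power_mono[of 26 L 2] L by simp
  have q_le: "real q \<le> L\<^sup>2 / 3" and q_gt: "L\<^sup>2 / 3 < real q + 1"
    using L2 by (simp_all add: q_def of_nat_nat) linarith+
  then show "real q \<le> L\<^sup>2 / 3" by simp
  show q225: "225 \<le> q" using q_gt L2 by linarith
  define x where "x = ln (real q)"
  have l4: "ln (4::real) = 2 * ln 2" "ln (256::real) = 8 * ln 2"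
    using ln_realpow[of "2::real" 2] ln_realpow[of "2::real" 8] by simp_all
  \<comment> \<open>the tangent of the logarithm at 256, a power of 2 near the smallest value of \<open>q\<close>\<close>
  have tangent: "ln t \<le> (45453 / 10000) + t / 256" if "t > 0" for t :: real
  proof -
    have "ln (t / 256) \<le> t / 256 - 1" using that by (intro ln_le_minus_one) auto
    then show ?thesis using that l4 ln_2_bounds by (simp add: ln_div)
  qed
  have ln9: "ln (9::real) \<le> (22183 / 10000)"
  proof -
    have "5 * ln (9::real) = ln (9 ^ 5)" by (subst ln_realpow) auto
    also have "\<dots> \<le> ln (2 ^ 16)" by simp
    also have "\<dots> = 16 * ln 2" by (subst ln_realpow) auto
    finally show ?thesis using ln_2_bounds by simp
  qed
  show w: "1 + mertens_sum (q - 1) - ln q \<le> (3383 / 2000)"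
  proof -
    define a where "a = real (q - 1)"
    have a: "a \<ge> 224" "a \<le> q" using q225 by (auto simp: a_def)
    define E where "E = (5 * ln a + 1) / a"
    have "E \<le> (5 * (45453 / 10000 + a / 256) + 1) / a"
      unfolding E_def using tangent[of a] a by (intro divide_right_mono) auto
    also have "\<dots> = 5 / 256 + (47453 / 2000) / a" using a by (simp add: field_simps)
    also have "\<dots> \<le> 5 / 256 + (47453 / 2000) / 224"
      using a by (intro add_left_mono divide_left_mono) auto
    also have "\<dots> \<le> 12546 / 100000" by simp
    finally have "E \<le> 12546 / 100000" .
    moreover have "ln a \<le> ln q" using a by simp
    moreover have "mertens_sum (q - 1) \<le> ln a - 1 + ln 4 + (ln 9 + 1) / 18 + E"
      using q225 unfolding a_def E_def by (intro mertens_sum_upper) auto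
    moreover have "(ln 9 + 1) / 18 \<le> (17880 / 100000 :: real)" using ln9 by simp
    moreover have "ln 4 \<le> (13864 / 10000 :: real)" using l4(1) ln_2_bounds by simp
    ultimately show ?thesis by linarith
  qed
  have x_ge: "x \<ge> (537 / 100)"
  proof -
    have "(31 / 4) * ln 2 \<le> ln (225::real)"
      using ln_ge_of_power[of 31 225 4] by simp
    also have "\<dots> \<le> x" using q225 by (simp add: x_def)
    finally show ?thesis using ln_2_bounds by simp
  qed
  have ln3: "ln (3::real) \<ge> (1089 / 1000)"
    using ln_ge_of_power[of 11 3 7] ln_2_bounds by simp
  have x_le: "x \<le> 2 * ln L - ln 3"
  proof -
    have "x \<le> ln (L\<^sup>2 / 3)" unfolding x_def using q_le q225 by (intro ln_mono) auto
    also have "\<dots> = 2 * ln L - ln 3" using L by (simp add: ln_div ln_realpow)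
    finally show ?thesis .
  qed
  define d where "d = 1 / (2 * (real q - 2))"
  have d: "0 \<le> d" "d \<le> 1 / 446" using q225 by (auto simp: d_def field_simps)
  have xd: "x * d \<le> (123 / 10000)"
  proof -
    have "x * d \<le> ((45453 / 10000) + q / 256) * d"
      unfolding x_def using tangent[of q] q225 d by (intro mult_right_mono) auto
    also have "\<dots> = ((45453 / 10000) + 2 / 256) * d + (real q - 2) * d / 256" by (simp add: field_simps)
    finally have "x * d \<le> ((45453 / 10000) + 2 / 256) * d + (real q - 2) * d / 256" .
    moreover have "(real q - 2) * d = 1 / 2" using q225 by (simp add: d_def)
    moreover have "((45453 / 10000) + 2 / 256) * d \<le> ((45453 / 10000) + 2 / 256) * (1 / 446)"
      using d by (intro mult_left_mono) auto
    ultimately show ?thesis by simp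
  qed
  define y where "y = (3383 / 2000) / x + d"
  have xy: "x * y \<le> (8519 / 5000)" using xd x_ge by (simp add: y_def distrib_left)
  have y0: "0 \<le> y" using d x_ge by (simp add: y_def)
  have y_le: "y \<le> (3173 / 10000)"
  proof -
    have "(3383 / 2000) / x \<le> (3383 / 2000) / (537 / 100)" using x_ge by (intro divide_left_mono) auto
    then show ?thesis using d by (simp add: y_def)
  qed
  have "x * exp y \<le> x * (1 + y + (3 / 5) * y\<^sup>2)"
    using exp_le_quadratic[OF y0] y_le x_ge by (intro mult_left_mono) auto
  also have "\<dots> = x + x * y + (3 / 5) * (x * y * y)" by (simp add: algebra_simps power2_eq_square)
  finally have "x * exp y \<le> x + x * y + (3 / 5) * (x * y * y)" .
  moreover have "x * y * y \<le> 541 / 1000"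
  proof -
    have "x * y * y \<le> (8519 / 5000) * (3173 / 10000)"
      using xy y_le y0 x_ge by (intro mult_mono) auto
    then show ?thesis by simp
  qed
  ultimately have xexp: "x * exp y \<le> 2 * ln L + (47 / 50)" using xy x_le ln3 by linarith
  have e: "exp (13 / 22 :: real) \<le> (227 / 125)"
  proof -
    have "(1 / (227 / 125) :: real) \<le> (1 - (13 / 22) / real 32) ^ 32" by (simp add: field_simps)
    also have "\<dots> \<le> exp (- (13 / 22))" by (rule exp_ge_one_minus_x_over_n_power_n) auto
    finally show ?thesis by (simp add: exp_minus field_simps)
  qed
  have lnL: "ln L \<ge> (3257 / 1000)"
  proof -
    have "(47 / 10) * ln 2 \<le> ln (26::real)" using ln_ge_of_power[of 47 26 10] by simp
    also have "\<dots> \<le> ln L" using L by simp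
    finally show ?thesis using ln_2_bounds by simp
  qed
  have "exp (13 / 22) * (x * exp y) \<le> (227 / 125) * (2 * ln L + (47 / 50))"
    using e xexp x_ge by (intro mult_mono) auto
  moreover have "L\<^sup>2 * d \<le> (1521 / 1000)"
  proof -
    have "L\<^sup>2 \<le> (1521 / 1000) * (2 * (real q - 2))" using q_gt L2 by simp
    then show ?thesis using q225 by (simp add: d_def field_simps)
  qed
  moreover have "(227 / 125) * (2 * ln L + (47 / 50)) + (1521 / 1000) \<le> (933 / 200) * ln L"
    using lnL by (simp add: field_simps)
  moreover have "x * exp (13 / 22 + y) = exp (13 / 22) * (x * exp y)" by (simp add: exp_add)
  ultimately have "x * exp (13 / 22 + y) + L\<^sup>2 * d \<le> (933 / 200) * ln L"
    by linarith
  then show "ln q * exp (13 / 22 + ((3383 / 2000) / ln q + 1 / (2 * (real q - 2)))) + L\<^sup>2 / (2 * (real q - 2))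
      \<le> (933 / 200) * ln L"
    by (simp add: x_def y_def d_def)
qed

lemma card_not_powering_to_prime_cycle_le:
  fixes n :: nat
  assumes n: "real n \<ge> exp 12"
  shows "real (card {g. g permutes {1..n} \<and> \<not> (\<exists>p. prime p \<and> p \<le> n - 3 \<and> powers_to_cycle p g)})
    \<le> fact n * ((933 / 200) * ln (ln (real n)) / ln (real n - 3))"
proof -
  define L where "L = ln (real n)"
  have n0: "real n > 0" using n exp_gt_zero[of "12::real"] by linarith
  have L: "12 \<le> L" unfolding L_def using n n0 by (subst ln_ge_iff) auto
  have expL: "exp L = real n" using n0 by (simp add: L_def)
  \<comment> \<open>both choices of \<open>q\<close> are at most \<open>L\<^sup>2 / 2\<close>, so this gives \<open>q + 2 \<le> n\<close>\<close>
  have n_ge: "real n \<ge> 1 + L + L\<^sup>2 / 2"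
    using exp_lower_Taylor_quadratic[of L] L expL by simp
  have lnn3: "ln (real n - 3) > 0" using n_ge L zero_le_power2[of L] by (intro ln_gt_zero) linarith
  obtain q :: nat and w :: real where q: "4 \<le> q" "real q \<le> L\<^sup>2 / 2"
    and w: "1 + mertens_sum (q - 1) - ln q \<le> w"
    and num: "ln q * exp (13 / 22 + (w / ln q + 1 / (2 * (real q - 2)))) + L\<^sup>2 / (2 * (real q - 2))
      \<le> (933 / 200) * ln L"
  proof (cases "L \<le> 26")
    case True
    have "L\<^sup>2 \<ge> 12\<^sup>2" using L by (intro power_mono) auto
    moreover have "1 + mertens_sum (64 - 1) - ln (real 64) \<le> 1 - (13 / 50) * ln 2"
      using mertens_sum_63 ln_realpow[of "2::real" 6] by simp
    ultimately show ?thesis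
      using that[of 64 "1 - (13 / 50) * ln 2"] threshold_64_suffices[OF L True] by simp
  next
    case False
    then have "L \<ge> 26" by simp
    note large = threshold_third_of_square_suffices[OF this]
    have "real (nat \<lfloor>L\<^sup>2 / 3\<rfloor>) \<le> L\<^sup>2 / 2" using large(4) zero_le_power2[of L] by linarith
    then show ?thesis using that[of "nat \<lfloor>L\<^sup>2 / 3\<rfloor>" "(3383 / 2000)"] large by simp
  qed
  let ?C = "{p. prime p \<and> q \<le> p \<and> p \<le> n - 3}"
  let ?T = "exp (13 / 22 - (\<Sum>p\<in>?C. 1 / real p)) + (\<Sum>p\<in>?C. harm (n div p) / (real p)\<^sup>2)"
  have "real q + 2 \<le> real n" using q n_ge L by linarith
  then have qn: "q + 2 \<le> n" by linarith
  have "?T * ln (real n - 3) \<le> (933 / 200) * ln L"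
    using prime_reciprocals_tail_le[OF q(1) qn w] num unfolding L_def by linarith
  then have T: "?T \<le> (933 / 200) * ln L / ln (real n - 3)" using lnn3 by (simp add: pos_le_divide_eq)
  have "real (card {g. g permutes {1..n} \<and> \<not> (\<exists>p. prime p \<and> p \<le> n - 3 \<and> powers_to_cycle p g)})
      \<le> fact n * ?T"
    using qn by (intro card_not_powering_le) auto
  also have "\<dots> \<le> fact n * ((933 / 200) * ln L / ln (real n - 3))"
    using T by (intro mult_left_mono) auto
  finally show ?thesis by (simp add: L_def)
qed

theorem theorem10:
  fixes n :: nat and G :: "(nat \<Rightarrow> nat) set" and \<rho> \<delta> :: real
  assumes "real n \<ge> exp 12"
    and "subgroup G (sym_group n)"
    and "carrier (alt_group n) \<subseteq> G"
    and "\<rho> = proportion G (\<lambda>g. \<exists>p. prime p \<and> p \<le> n - 3 \<and> powers_to_cycle p g)"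
    and "\<delta> = fact n / real (card G)"
  shows "\<delta> \<in> {1, 2} \<and>
    \<rho> \<ge> 1 - (4.58 * \<delta> + 0.17) * ln (ln (real n)) / ln (real n - 3)"
proof
  have "(13::real) \<le> exp 12" using exp_ge_add_one_self[of "12::real"] by simp
  then have n13: "real n \<ge> 13" using assms(1) by (rule order_trans)
  then show \<delta>: "\<delta> \<in> {1, 2}"
    unfolding assms(5) by (intro index_of_group_above_alternating assms) linarith
  define y where "y = ln (ln (real n)) / ln (real n - 3)"
  have "ln (real n) \<ge> 12" using assms(1) n13 by (subst ln_ge_iff) auto
  then have y: "y \<ge> 0" using n13 by (auto simp: y_def)
  have "\<rho> \<ge> 1 - \<delta> * (933 / 200 * ln (ln (real n)) / ln (real n - 3))"
    unfolding assms(4,5)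
    by (rule proportion_subgroup_ge[OF assms(2) card_not_powering_to_prime_cycle_le[OF assms(1)]])
  moreover have "\<delta> * (933 / 200) * y \<le> (4.58 * \<delta> + 0.17) * y"
    using \<delta> y by (intro mult_right_mono) auto
  ultimately show "\<rho> \<ge> 1 - (4.58 * \<delta> + 0.17) * ln (ln (real n)) / ln (real n - 3)"
    by (simp add: y_def)
qed

end
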